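(* Let $d\ge 1$, $\alpha\ge 1$, $C_0>0$. Let $\widehat{\mathbf f}^{\rm YF}_{h,h_y}$ denote the local polynomial regression (LPR) estimator of degree $r\ge\lfloor\alpha\rfloor$ with Yaroslavsky's weights $\omega_{i,j}=\mathbf 1\{\|x_i-x_j\|_\infty\le h\}\,\mathbf 1\{|y_i-y_j|\le h_y\}$. Suppose that there is a fixed cumulative distribution function $F$ with $$\mathbb P(|\varepsilon_i|\le t)\ge F(t/\sigma)\qquad\text{for all } t \text{ and all } i\in I_n^d,$$ and that, for some constants $C,b>0$, $1-F(t)\le C\exp(-(t/C)^b)$ for $t$ large enough. Then there is another constant $C'>0$ such that, if $\sigma\le (C'\log n)^{-1/b}$, $$\inf_{h,h_y}\ \mathcal R_n\big(\widehat{\mathbf f}^{\rm YF}_{h,h_y},\ \mathcal F^{\rm cartoon}(\alpha,C_0)\big)\ \le\ (1+o(1))\,\mathcal R^{\rm MO},\qquad \mathcal R^{\rm MO}:=(\sigma^2/n^d)^{2\alpha/(d+2\alpha)},$$ where an optimal choice of bandwidths is $h\asymp h^{\rm MO}:=(\sigma^2/n^d)^{1/(d+2\alpha)}$ and $h_y\asymp1$.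
   Context: Notation: $a_n\asymp b_n$ means that $a_n/b_n$ and $b_n/a_n$ are both bounded from above; $o(1)$ is as $n\to\infty$. $\lfloor\alpha\rfloor$ is the largest integer strictly less than $\alpha$. Model: for $i\in I_n^d$, $I_n=\{1,\dots,n\}$, one observes $y_i=f(x_i)+\varepsilon_i$, where $f:[0,1]^d\to[0,1]$, $x_i=((i_1-1/2)/n,\dots,(i_d-1/2)/n)$, and the $\varepsilon_i$ are uncorrelated with mean $0$ and variance $\sigma^2$. Put $f_i=f(x_i)$. For an estimator $\widehat{\mathbf f}=(\widehat f_i)_{i\in I_n^d}$, ${\rm MSE}_f(\widehat{\mathbf f})=n^{-d}\sum_{i\in I_n^d}\mathbb E(\widehat f_i-f_i)^2$ and $\mathcal R_n(\widehat{\mathbf f},\mathcal F)=\sup_{f\in\mathcal F}{\rm MSE}_f(\widehat{\mathbf f})$. Hölder class: $\mathcal H_d(\alpha,C_0)$ is the set of $g:[0,1]^d\to[0,1]$ that are $\lfloor\alpha\rfloor$ times differentiable with $|g^{(s)}(x)|\le C_0$ for all $x$ and all multi-indices $1\le|s|\le\lfloor\alpha\rfloor$, and $|g^{(s)}(x)-g^{(s)}(x')|\le C_0\|x-x'\|_\infty^{\alpha-\lfloor\alpha\rfloor}$ for all $x,x'$ and $|s|=\lfloor\alpha\rfloor$. Cartoon class: $\mathcal F^{\rm cartoon}(\alpha,C_0)$ is the set of $f=\mathbf 1_{\Omega}f_\Omega+\mathbf 1_{\Omega^c}f_{\Omega^c}$ with $f_\Omega,f_{\Omega^c}\in\mathcal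 H_d(\alpha,C_0)$, $\mu(f):=\inf_{x\in\partial\Omega}|f_\Omega(x)-f_{\Omega^c}(x)|\ge 1/C_0$, and $\Omega=\phi(B)\subset(0,1)^d$ where $B$ is the Euclidean unit ball and $\phi:\mathbb R^d\to\mathbb R^d$ is injective with $\phi$ and $\phi^{-1}$ both $C_0$-Lipschitz for the sup norm. LPR estimator of degree $r$ with weights $\omega_{i,j}$: $\widehat f_i=\widehat a^{(i)}_0$, where $\widehat{\mathbf a}^{(i)}$ minimizes $\sum_{j}\omega_{i,j}\big(y_j-\sum_{0\le|s|\le r}a_s(x_j-x_i)^s\big)^2$ over $\mathbf a=(a_s)_{|s|\le r}$; when the nonzero weights are not enough to determine $\widehat f_i$ uniquely, $\widehat f_i:=y_i$. All estimators are clipped to take values in $[0,1]$.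
   Formalization: The bound is proved as (1+o(1))·K·R^MO with a constant K>0 depending only on d, α, C_0, r; with constant 1 it is false, since for large C_0 every estimator has worst-case risk at least c·C_0^{2/3}(σ²/n)^{2/3} (d=α=1, Gaussian noise). *)

theory Defs
  imports "HOL-Probability.Probability" "HOL-Library.Landau_Symbols"
begin

text \<open>The ambient space is \<open>real^'d\<close>, so the dimension \<open>d\<close> is \<open>CARD('d)\<close>; multi-indices are
  elements of \<open>nat^'d\<close>, and \<open>infnorm\<close> is the sup norm.\<close>

section \<open>Observation model\<close>

definition grid :: "nat \<Rightarrow> (nat^'d) set" where
  "grid n = {i. \<forall>k. i $ k \<in> {1..n}}"

definition design :: "nat \<Rightarrow> nat^'d \<Rightarrow> real^'d" where
  "design n i = (\<chi> k. (real (i $ k) - 1/2) / real n)"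

definition uncorrelated_noise :: "'a measure \<Rightarrow> 'i set \<Rightarrow> ('i \<Rightarrow> 'a \<Rightarrow> real) \<Rightarrow> real \<Rightarrow> bool" where
  "uncorrelated_noise M I \<epsilon> \<sigma> \<longleftrightarrow>
     prob_space M \<and>
     (\<forall>i\<in>I. \<epsilon> i \<in> borel_measurable M \<and> integrable M (\<lambda>\<omega>. (\<epsilon> i \<omega>)\<^sup>2) \<and>
        prob_space.expectation M (\<epsilon> i) = 0 \<and> prob_space.variance M (\<epsilon> i) = \<sigma>\<^sup>2) \<and>
     (\<forall>i\<in>I. \<forall>j\<in>I. i \<noteq> j \<longrightarrow>
        prob_space.expectation M (\<lambda>\<omega>. (\<epsilon> i \<omega> - prob_space.expectation M (\<epsilon> i)) *
                                     (\<epsilon> j \<omega> - prob_space.expectation M (\<epsilon> j))) = 0)"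

section \<open>Function classes\<close>

abbreviation unit_cube :: "(real^'d) set" where
  "unit_cube \<equiv> cbox 0 One"

text \<open>The largest integer strictly less than \<open>\<alpha>\<close> (not the usual floor when \<open>\<alpha>\<close> is an integer).\<close>

definition sfloor :: "real \<Rightarrow> nat" where
  "sfloor \<alpha> = nat (\<lceil>\<alpha>\<rceil> - 1)"

lemma sfloor_eq_Greatest:
  assumes "\<alpha> > 0"
  shows "sfloor \<alpha> = (GREATEST m. real m < \<alpha>)"
proof (rule sym, rule Greatest_equality)
  show "real (sfloor \<alpha>) < \<alpha>"
    using assms unfolding sfloor_def by linarith
  show "m \<le> sfloor \<alpha>" if "real m < \<alpha>" for m
    using that unfolding sfloor_def by linarith
qed

definition mi_order :: "nat^'d \<Rightarrow> nat" where
  "mi_order s = (\<Sum>k\<in>UNIV. s $ k)"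

definition mi_power :: "real^'d \<Rightarrow> nat^'d \<Rightarrow> real" where
  "mi_power x s = (\<Prod>k\<in>UNIV. (x $ k) ^ (s $ k))"

text \<open>\<open>g\<close> is \<open>m\<close> times (Frechet) differentiable on the closed unit cube, with one-sided
  derivatives at its boundary, and \<open>D s\<close> is the partial derivative of \<open>g\<close> of multi-index \<open>s\<close>
  for every \<open>s\<close> of order at most \<open>m\<close>.  Since derivatives within the cube are unique, these
  \<open>D s\<close> are determined by \<open>g\<close> on the cube.\<close>

definition cube_derivs ::
    "nat \<Rightarrow> (real^'d \<Rightarrow> real) \<Rightarrow> (nat^'d \<Rightarrow> real^'d \<Rightarrow> real) \<Rightarrow> bool" where
  "cube_derivs m g D \<longleftrightarrow>
     (\<forall>x\<in>unit_cube. D 0 x = g x) \<and>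
     (\<forall>s. mi_order s < m \<longrightarrow> (\<forall>x\<in>unit_cube.
        (D s has_derivative (\<lambda>v. \<Sum>k\<in>UNIV. v $ k * D (s + axis k 1) x)) (at x within unit_cube)))"

definition holder_class :: "real \<Rightarrow> real \<Rightarrow> (real^'d \<Rightarrow> real) set" where
  "holder_class \<alpha> C0 = {g.
     (\<forall>x\<in>unit_cube. g x \<in> {0..1}) \<and>
     (\<exists>D. cube_derivs (sfloor \<alpha>) g D \<and>
        (\<forall>s. 1 \<le> mi_order s \<and> mi_order s \<le> sfloor \<alpha> \<longrightarrow> (\<forall>x\<in>unit_cube. \<bar>D s x\<bar> \<le> C0)) \<and>
        (\<forall>s. mi_order s = sfloor \<alpha> \<longrightarrow> (\<forall>x\<in>unit_cube. \<forall>x'\<in>unit_cube.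
           \<bar>D s x - D s x'\<bar> \<le> C0 * infnorm (x - x') powr (\<alpha> - real (sfloor \<alpha>)))))}"

definition supnorm_lipschitz_on :: "real \<Rightarrow> (real^'d) set \<Rightarrow> (real^'d \<Rightarrow> real^'d) \<Rightarrow> bool" where
  "supnorm_lipschitz_on L S \<psi> \<longleftrightarrow> (\<forall>x\<in>S. \<forall>y\<in>S. infnorm (\<psi> x - \<psi> y) \<le> L * infnorm (x - y))"

text \<open>Membership only constrains the values of a function on the unit cube.\<close>

definition cartoon_class :: "real \<Rightarrow> real \<Rightarrow> (real^'d \<Rightarrow> real) set" where
  "cartoon_class \<alpha> C0 = {f. \<exists>f1 f2 \<Omega> \<phi>.
     f1 \<in> holder_class \<alpha> C0 \<and> f2 \<in> holder_class \<alpha> C0 \<and>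
     inj \<phi> \<and> supnorm_lipschitz_on C0 UNIV \<phi> \<and> supnorm_lipschitz_on C0 (range \<phi>) (inv \<phi>) \<and>
     \<Omega> = \<phi> ` cball 0 1 \<and> \<Omega> \<subseteq> box 0 One \<and>
     (INF x\<in>frontier \<Omega>. \<bar>f1 x - f2 x\<bar>) \<ge> 1 / C0 \<and>
     (\<forall>x\<in>unit_cube. f x = indicator \<Omega> x * f1 x + indicator (- \<Omega>) x * f2 x)}"

section \<open>Local polynomial regression\<close>

definition lpr_criterion ::
    "nat \<Rightarrow> nat \<Rightarrow> (nat^'d \<Rightarrow> nat^'d \<Rightarrow> real) \<Rightarrow> (nat^'d \<Rightarrow> real) \<Rightarrow> nat^'d \<Rightarrow> (nat^'d \<Rightarrow> real) \<Rightarrow> real"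
  where
  "lpr_criterion n r w y i a =
     (\<Sum>j\<in>grid n. w i j *
        (y j - (\<Sum>s | mi_order s \<le> r. a s * mi_power (design n j - design n i) s))\<^sup>2)"

definition clip :: "real \<Rightarrow> real" where
  "clip v = max 0 (min 1 v)"

text \<open>The fallback to \<open>y i\<close> concerns the value of the constant coefficient only: it may be the
  same for all minimizers although the minimizer itself is not unique.\<close>

definition lpr_estimator ::
    "nat \<Rightarrow> nat \<Rightarrow> (nat^'d \<Rightarrow> nat^'d \<Rightarrow> real) \<Rightarrow> (nat^'d \<Rightarrow> real) \<Rightarrow> nat^'d \<Rightarrow> real" where
  "lpr_estimator n r w y i =
     (let V = {a 0 | a. is_arg_min (lpr_criterion n r w y i) (\<lambda>_. True) a}
      in clip (if \<exists>!v. v \<in> V then THE v. v \<in> V else y i))"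

definition yaroslavsky_weights ::
    "nat \<Rightarrow> real \<Rightarrow> real \<Rightarrow> (nat^'d \<Rightarrow> real) \<Rightarrow> nat^'d \<Rightarrow> nat^'d \<Rightarrow> real" where
  "yaroslavsky_weights n h hy y i j =
     of_bool (infnorm (design n i - design n j) \<le> h) * of_bool (\<bar>y i - y j\<bar> \<le> hy)"

definition yf_estimator ::
    "nat \<Rightarrow> nat \<Rightarrow> real \<Rightarrow> real \<Rightarrow> (nat^'d \<Rightarrow> real) \<Rightarrow> nat^'d \<Rightarrow> real" where
  "yf_estimator n r h hy y = lpr_estimator n r (yaroslavsky_weights n h hy y) y"

section \<open>Risk\<close>

text \<open>An estimator maps the data \<open>(y i)\<close> to the fitted values; risks take values in \<open>ennreal\<close>, so
  that the supremum over an empty class is \<open>0\<close>.\<close>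

definition mse ::
    "'a measure \<Rightarrow> nat \<Rightarrow> (nat^'d \<Rightarrow> 'a \<Rightarrow> real) \<Rightarrow> ((nat^'d \<Rightarrow> real) \<Rightarrow> nat^'d \<Rightarrow> real) \<Rightarrow>
     (real^'d \<Rightarrow> real) \<Rightarrow> ennreal" where
  "mse M n \<epsilon> T f =
     (\<Sum>i\<in>grid n. \<integral>\<^sup>+\<omega>. ennreal ((T (\<lambda>j. f (design n j) + \<epsilon> j \<omega>) i - f (design n i))\<^sup>2) \<partial>M)
       / ennreal (real n ^ CARD('d))"

definition risk ::
    "'a measure \<Rightarrow> nat \<Rightarrow> (nat^'d \<Rightarrow> 'a \<Rightarrow> real) \<Rightarrow> ((nat^'d \<Rightarrow> real) \<Rightarrow> nat^'d \<Rightarrow> real) \<Rightarrow>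
     (real^'d \<Rightarrow> real) set \<Rightarrow> ennreal" where
  "risk M n \<epsilon> T \<F> = (SUP f\<in>\<F>. mse M n \<epsilon> T f)"

text \<open>Rate of the membership oracle and the corresponding bandwidth; \<open>d\<close> is the dimension.\<close>

definition rate_MO :: "nat \<Rightarrow> real \<Rightarrow> real \<Rightarrow> nat \<Rightarrow> real" where
  "rate_MO d \<alpha> \<sigma> n = (\<sigma>\<^sup>2 / real n ^ d) powr (2 * \<alpha> / (real d + 2 * \<alpha>))"

definition bandwidth_MO :: "nat \<Rightarrow> real \<Rightarrow> real \<Rightarrow> nat \<Rightarrow> real" where
  "bandwidth_MO d \<alpha> \<sigma> n = (\<sigma>\<^sup>2 / real n ^ d) powr (1 / (real d + 2 * \<alpha>))"

end

theory Submission
  imports Defs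
begin

text \<open>
  Take \<open>h\<close> equal to the oracle bandwidth and threshold at \<open>1 / (2 * C0)\<close>.  Unless some noise
  variable exceeds \<open>1 / (16 * C0)\<close>, which has probability at most \<open>n\<^sup>d\<close> times the tail, the
  threshold selects exactly the pixels of the window that lie in the same region, so that the
  estimator is least squares on that set, with hat matrix \<open>H\<close>.  The centre always belongs to the
  set, hence its fitted value is unique, and as \<open>H\<close> is an orthogonal projection, variance and
  squared bias at pixel \<open>i\<close> are bounded by the leverage \<open>H i i\<close> times \<open>\<sigma>\<^sup>2\<close> and times
  (window size) \<open>* h powr (2 * \<alpha>)\<close>, respectively.

  The selected set can be an arbitrarily thin layer when \<open>\<Omega>\<close> comes close to the boundary of the
  cube, so single leverages need not be small; only their average is.  Leverages decrease
  when the set grows, so they are bounded by those of the fit to one cell of a partition into cells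
  of side \<open>h\<close>, cut by the two regions, and the leverages on one cell sum to at most the dimension of
  the polynomial space.  Hence their average over the grid is of order \<open>1 / (n * h)\<^sup>d\<close>.

  If \<open>n * h < 1\<close>, the window is a single pixel and the estimator is the clipped observation,
  whose risk \<open>\<sigma>\<^sup>2\<close> is below the rate; otherwise the rate is at least \<open>n powr (- 2 * \<alpha>)\<close>,
  which dominates the probability of a large noise variable.
\<close>

section \<open>Kernels of least-squares projections\<close>

text \<open>On \<open>S\<close> this is the hat matrix of least squares, the orthogonal projection
  onto the span of the \<open>g s\<close>. Characterising it by properties, not by an inverse Gram
  matrix, covers linearly dependent functions, as on sets with few pixels.\<close>

definition projection_kernel ::
    "('s \<Rightarrow> 'i \<Rightarrow> real) \<Rightarrow> 's set \<Rightarrow> 'i set \<Rightarrow> ('i \<Rightarrow> 'i \<Rightarrow> real) \<Rightarrow> bool" where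
  "projection_kernel g J S H \<longleftrightarrow>
     (\<forall>i\<in>S. \<forall>j\<in>S. H i j = H j i) \<and>
     (\<forall>s\<in>J. \<forall>i\<in>S. (\<Sum>j\<in>S. H i j * g s j) = g s i) \<and>
     (\<forall>i\<in>S. \<exists>a. \<forall>j\<in>S. H i j = (\<Sum>s\<in>J. a s * g s j))"

lemma projection_kernelD:
  assumes "projection_kernel g J S H"
  shows "\<And>i j. i \<in> S \<Longrightarrow> j \<in> S \<Longrightarrow> H i j = H j i"
    and "\<And>s i. s \<in> J \<Longrightarrow> i \<in> S \<Longrightarrow> (\<Sum>j\<in>S. H i j * g s j) = g s i"
    and "\<And>i. i \<in> S \<Longrightarrow> \<exists>a. \<forall>j\<in>S. H i j = (\<Sum>s\<in>J. a s * g s j)"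
  using assms unfolding projection_kernel_def by blast+

lemma projection_kernel_reproduce:
  assumes "projection_kernel g J S H" "i \<in> S" "\<forall>j\<in>S. p j = (\<Sum>s\<in>J. a s * g s j)"
  shows "(\<Sum>j\<in>S. H i j * p j) = p i"
proof -
  have "(\<Sum>j\<in>S. H i j * p j) = (\<Sum>j\<in>S. \<Sum>s\<in>J. a s * (H i j * g s j))"
    by (intro sum.cong refl) (simp add: assms(3) sum_distrib_left mult.left_commute)
  also have "\<dots> = (\<Sum>s\<in>J. a s * (\<Sum>j\<in>S. H i j * g s j))"
    by (subst sum.swap) (simp add: sum_distrib_left)
  also have "\<dots> = p i"
    by (simp add: projection_kernelD(2)[OF assms(1)] assms(2,3))
  finally show ?thesis .
qed

text \<open>Each row lies in the span, so the kernel reproduces it. For \<open>i = j\<close>, the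
  squared norm of a row is the leverage \<open>H i i\<close>, which is how both variance and bias
  become leverages.\<close>

lemma projection_kernel_idem:
  assumes "projection_kernel g J S H" "i \<in> S" "j \<in> S"
  shows "(\<Sum>k\<in>S. H i k * H j k) = H j i"
proof -
  obtain a where "\<forall>k\<in>S. H j k = (\<Sum>s\<in>J. a s * g s k)"
    using projection_kernelD(3)[OF assms(1,3)] by blast
  then show ?thesis
    using projection_kernel_reproduce[OF assms(1,2)] by blast
qed

text \<open>Gram-Schmidt: functions enter one at a time, each adding the rank-one projection onto
  its part orthogonal to the earlier ones. The trace grows by 1, or by 0 if the function is already
  in the span on \<open>S\<close>.\<close>

lemma projection_kernel_exists:
  fixes g :: "'s \<Rightarrow> 'i \<Rightarrow> real"
  assumes "finite J" "finite S"
  shows "\<exists>H. projection_kernel g J S H \<and> (\<Sum>i\<in>S. H i i) \<le> real (card J)"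
  using assms(1)
proof (induction J rule: finite_induct)
  case empty
  have "projection_kernel g {} S (\<lambda>_ _. 0)"
    by (auto simp: projection_kernel_def)
  then show ?case by (intro exI[of _ "\<lambda>_ _. 0"]) auto
next
  case (insert s J)
  then obtain H where H: "projection_kernel g J S H" and tr: "(\<Sum>i\<in>S. H i i) \<le> real (card J)"
    by blast
  note sym = projection_kernelD(1)[OF H] and rep = projection_kernelD(2)[OF H]
  obtain A where A: "\<And>i j. i \<in> S \<Longrightarrow> j \<in> S \<Longrightarrow> H i j = (\<Sum>t\<in>J. A i t * g t j)"
    using projection_kernelD(3)[OF H] by metis
  \<comment> \<open>\<open>\<rho>\<close> is the residual of the new function after projection onto
    the old span, and \<open>Q\<close> its squared norm.\<close>
  define \<rho> where "\<rho> i = g s i - (\<Sum>j\<in>S. H i j * g s j)" for i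
  define Q where "Q = (\<Sum>i\<in>S. \<rho> i * \<rho> i)"
  have orth: "(\<Sum>j\<in>S. \<rho> j * g t j) = 0" if "t \<in> J" for t
  proof -
    have "(\<Sum>j\<in>S. \<rho> j * g t j) = (\<Sum>j\<in>S. g s j * g t j) - (\<Sum>j\<in>S. \<Sum>k\<in>S. g s k * (H j k * g t j))"
      unfolding \<rho>_def left_diff_distrib sum_subtractf sum_distrib_right by (simp only: mult_ac)
    also have "(\<Sum>j\<in>S. \<Sum>k\<in>S. g s k * (H j k * g t j)) = (\<Sum>k\<in>S. g s k * (\<Sum>j\<in>S. H k j * g t j))"
      by (subst sum.swap) (auto simp: sum_distrib_left sym intro!: sum.cong)
    also have "\<dots> = (\<Sum>k\<in>S. g s k * g t k)"
      by (simp add: rep that)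
    finally show ?thesis by simp
  qed
  have Hrho: "(\<Sum>j\<in>S. \<rho> j * H i j) = 0" if "i \<in> S" for i
  proof -
    have "(\<Sum>j\<in>S. \<rho> j * H i j) = (\<Sum>j\<in>S. \<Sum>t\<in>J. A i t * (\<rho> j * g t j))"
      using that by (intro sum.cong refl) (simp add: A sum_distrib_left mult_ac)
    also have "\<dots> = (\<Sum>t\<in>J. A i t * (\<Sum>j\<in>S. \<rho> j * g t j))"
      by (subst sum.swap) (simp add: sum_distrib_left)
    finally show ?thesis by (simp add: orth)
  qed
  \<comment> \<open>\<open>g s\<close> is \<open>\<rho>\<close> plus its projection onto the old
    span, and the latter is orthogonal to \<open>\<rho>\<close>.\<close>
  have Qs: "(\<Sum>j\<in>S. \<rho> j * g s j) = Q"
  proof -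
    have "Q = (\<Sum>j\<in>S. \<rho> j * g s j) - (\<Sum>j\<in>S. \<Sum>k\<in>S. g s k * (\<rho> j * H j k))"
      unfolding Q_def by (subst (2) \<rho>_def, unfold right_diff_distrib sum_subtractf sum_distrib_left)
        (simp only: mult_ac)
    also have "(\<Sum>j\<in>S. \<Sum>k\<in>S. g s k * (\<rho> j * H j k)) = (\<Sum>k\<in>S. g s k * (\<Sum>j\<in>S. \<rho> j * H k j))"
      by (subst sum.swap) (auto simp: sum_distrib_left sym intro!: sum.cong)
    finally show ?thesis by (simp add: Hrho)
  qed
  \<comment> \<open>If \<open>g s\<close> already lies in the span, then \<open>\<rho> = 0\<close> on \<open>S\<close>, \<open>Q = 0\<close>, and the junk
    value of the division by zero makes the update trivial.\<close>
  define H' where "H' i j = H i j + \<rho> i * \<rho> j / Q" for i j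
  have rho0: "\<rho> i = 0" if "Q = 0" "i \<in> S" for i
    using that assms(2) unfolding Q_def by (subst (asm) sum_nonneg_eq_0_iff) auto
  have "\<exists>a. \<forall>j\<in>S. H' i j = (\<Sum>t\<in>insert s J. a t * g t j)" if i: "i \<in> S" for i
  proof -
    \<comment> \<open>\<open>b\<close> holds the coefficients of the old projection of
      \<open>g s\<close>. Writing \<open>\<rho>\<close> as \<open>g s\<close> minus this combination
      puts the updated row into the enlarged span.\<close>
    define c where "c = \<rho> i / Q"
    define b where "b t = (\<Sum>k\<in>S. g s k * A k t)" for t
    have rho: "\<rho> j = g s j - (\<Sum>t\<in>J. b t * g t j)" if "j \<in> S" for j
    proof -
      have "(\<Sum>k\<in>S. H j k * g s k) = (\<Sum>k\<in>S. \<Sum>t\<in>J. g s k * A k t * g t j)"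
        by (intro sum.cong refl)
          (simp only: sym[OF that] A[OF _ that] sum_distrib_left sum_distrib_right mult_ac)
      also have "\<dots> = (\<Sum>t\<in>J. b t * g t j)"
        by (subst sum.swap) (simp add: b_def sum_distrib_right)
      finally show ?thesis by (simp add: \<rho>_def)
    qed
    have "H' i j = (\<Sum>t\<in>insert s J. (if t = s then c else A i t - c * b t) * g t j)" if "j \<in> S" for j
    proof -
      have "(\<Sum>t\<in>J. (if t = s then c else A i t - c * b t) * g t j) = (\<Sum>t\<in>J. (A i t - c * b t) * g t j)"
        using insert.hyps by (intro sum.cong) auto
      moreover have "(\<Sum>t\<in>J. (A i t - c * b t) * g t j) = H i j - c * (\<Sum>t\<in>J. b t * g t j)"
        by (simp add: A[OF i that] left_diff_distrib sum_subtractf sum_distrib_left mult.assoc)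
      moreover have "H' i j = H i j + c * (g s j - (\<Sum>t\<in>J. b t * g t j))"
        by (simp add: H'_def c_def rho[OF that, symmetric])
      ultimately show ?thesis
        using insert.hyps by (simp add: right_diff_distrib)
    qed
    then show ?thesis by (intro exI[of _ "\<lambda>t. if t = s then c else A i t - c * b t"]) blast
  qed
  moreover have "(\<Sum>j\<in>S. H' i j * g t j) = g t i" if "t \<in> insert s J" "i \<in> S" for t i
  proof -
    have eq: "(\<Sum>j\<in>S. H' i j * g t j) = (\<Sum>j\<in>S. H i j * g t j) + \<rho> i / Q * (\<Sum>j\<in>S. \<rho> j * g t j)"
      by (simp add: H'_def distrib_right sum.distrib sum_distrib_left mult.assoc)
    show ?thesis
    proof (cases "t = s")
      case True
      have "(\<Sum>j\<in>S. H i j * g s j) = g s i - \<rho> i"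
        by (simp add: \<rho>_def)
      then show ?thesis
        using rho0[OF _ that(2)] by (cases "Q = 0") (simp_all add: eq[unfolded True] True Qs)
    next
      case False
      then show ?thesis using that by (simp add: eq rep orth)
    qed
  qed
  ultimately have "projection_kernel g (insert s J) S H'"
    by (auto simp: projection_kernel_def H'_def sym)
  \<comment> \<open>The trace of the rank-one update is \<open>Q / Q\<close>, which is 1, or 0 in
    the degenerate case.\<close>
  moreover have "(\<Sum>i\<in>S. H' i i) = (\<Sum>i\<in>S. H i i) + Q / Q"
    unfolding H'_def sum.distrib sum_divide_distrib[symmetric] Q_def[symmetric] ..
  then have "(\<Sum>i\<in>S. H' i i) \<le> real (card (insert s J))"
    using tr insert.hyps by (cases "Q = 0") auto
  ultimately show ?case by blast
qed

text \<open>Row \<open>i\<close> of \<open>H\<close>, restricted to \<open>Q\<close>, lies in the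
  space fitted on \<open>Q\<close>, so \<open>H'\<close> reproduces its entry \<open>H i i\<close>.
  Cauchy-Schwarz and idempotence then give \<open>(H i i)\<^sup>2 \<le> H' i i * H i i\<close>. Two
  families \<open>g\<close> and \<open>g2\<close> occur because a window uses monomials centred at
  its own pixel and a cell uses one common family.\<close>

lemma leverage_mono:
  assumes Q: "projection_kernel g J Q H'" and S: "projection_kernel g2 J2 S H"
    and span: "\<forall>s\<in>J2. \<exists>a. \<forall>j\<in>S. g2 s j = (\<Sum>t\<in>J. a t * g t j)"
    and "Q \<subseteq> S" "i \<in> Q" "finite S"
  shows "H i i \<le> H' i i"
proof -
  have iS: "i \<in> S" using assms by auto
  obtain a where a: "\<forall>j\<in>S. H i j = (\<Sum>s\<in>J2. a s * g2 s j)"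
    using projection_kernelD(3)[OF S iS] by blast
  obtain b where b: "\<forall>s\<in>J2. \<forall>j\<in>S. g2 s j = (\<Sum>t\<in>J. b s t * g t j)"
    using span by metis
  have "H i j = (\<Sum>t\<in>J. (\<Sum>s\<in>J2. a s * b s t) * g t j)" if "j \<in> S" for j
  proof -
    have "H i j = (\<Sum>s\<in>J2. \<Sum>t\<in>J. a s * b s t * g t j)"
      using a b that by (simp add: sum_distrib_left mult_ac)
    then show ?thesis by (subst (asm) sum.swap) (simp add: sum_distrib_right)
  qed
  then have p: "(\<Sum>j\<in>Q. H' i j * H i j) = H i i"
    using \<open>Q \<subseteq> S\<close> by (intro projection_kernel_reproduce[OF Q \<open>i \<in> Q\<close>, where p = "H i" and a = "\<lambda>t. \<Sum>s\<in>J2. a s * b s t"]) auto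
  have "(\<Sum>j\<in>Q. (H i j)\<^sup>2) \<le> (\<Sum>j\<in>S. (H i j)\<^sup>2)"
    using assms by (intro sum_mono2) auto
  then have 1: "(\<Sum>j\<in>Q. (H i j)\<^sup>2) \<le> H i i"
    using projection_kernel_idem[OF S iS iS] by (simp add: power2_eq_square)
  have 2: "(\<Sum>j\<in>Q. (H' i j)\<^sup>2) = H' i i"
    using projection_kernel_idem[OF Q \<open>i \<in> Q\<close> \<open>i \<in> Q\<close>] by (simp add: power2_eq_square)
  have nn: "0 \<le> H' i i" "0 \<le> H i i"
  proof -
    have "0 \<le> (\<Sum>j\<in>Q. (H' i j)\<^sup>2)" "0 \<le> (\<Sum>j\<in>Q. (H i j)\<^sup>2)"
      by (simp_all add: sum_nonneg)
    then show "0 \<le> H' i i" "0 \<le> H i i" using 1 2 by linarith+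
  qed
  have "(H i i)\<^sup>2 \<le> H' i i * (\<Sum>j\<in>Q. (H i j)\<^sup>2)"
    using Cauchy_Schwarz_ineq_sum[of "H' i" "H i" Q] unfolding p 2 .
  also have "\<dots> \<le> H' i i * H i i"
    using 1 nn(1) by (rule mult_left_mono)
  finally have "H i i * H i i \<le> H' i i * H i i"
    by (simp only: power2_eq_square)
  \<comment> \<open>A positive \<open>H i i\<close> cancels; if it is zero, the claim is that
    \<open>H' i i\<close> is nonnegative.\<close>
  then show ?thesis
    using nn by (meson mult_right_le_imp_le order.trans not_le)
qed

section \<open>Local polynomial fits\<close>

lemma mi_power_0 [simp]: "mi_power x 0 = 1"
  by (simp add: mi_power_def)

lemma mi_power_zero: "mi_power 0 s = of_bool (s = 0)"
proof (cases "s = 0")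
  case False
  then obtain k where "s $ k \<noteq> 0" by (metis vec_eq_iff zero_index)
  then show ?thesis
    using False by (auto simp: mi_power_def intro!: prod_zero bexI[of _ k])
qed simp

lemma card_vec_box:
  fixes A :: "'d::finite \<Rightarrow> 'b set"
  assumes "\<And>k. finite (A k)"
  shows "finite {j :: 'b^'d. \<forall>k. j $ k \<in> A k}"
    and "card {j :: 'b^'d. \<forall>k. j $ k \<in> A k} = (\<Prod>k\<in>UNIV. card (A k))"
proof -
  have "bij_betw vec_nth {j :: 'b^'d. \<forall>k. j $ k \<in> A k} (PiE UNIV A)"
    by (rule bij_betwI[where g = vec_lambda]) auto
  moreover have "finite (PiE UNIV A)" "card (PiE UNIV A) = (\<Prod>k\<in>UNIV. card (A k))"
    by (auto intro!: finite_PiE assms card_PiE)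
  ultimately show "finite {j :: 'b^'d. \<forall>k. j $ k \<in> A k}"
    "card {j :: 'b^'d. \<forall>k. j $ k \<in> A k} = (\<Prod>k\<in>UNIV. card (A k))"
    by (auto dest: bij_betw_finite bij_betw_same_card)
qed

lemma finite_grid [simp]: "finite (grid n)"
  unfolding grid_def by (rule card_vec_box(1)[where A = "\<lambda>_. {1..n}"]) simp

lemma card_grid: "card (grid n :: (nat^'d) set) = n ^ CARD('d)"
  unfolding grid_def by (simp add: card_vec_box(2)[where A = "\<lambda>_. {1..n}", simplified])

lemma finite_mi_order_le [simp]: "finite {s :: nat^'d. mi_order s \<le> r}"
proof (rule finite_subset)
  show "{s :: nat^'d. mi_order s \<le> r} \<subseteq> {s. \<forall>k. s $ k \<in> {..r}}"
  proof (intro subsetI CollectI allI)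
    fix s :: "nat^'d" and k
    assume "s \<in> {s. mi_order s \<le> r}"
    moreover have "s $ k \<le> mi_order s"
      unfolding mi_order_def by (rule member_le_sum) auto
    ultimately show "s $ k \<in> {..r}" by simp
  qed
  show "finite {s :: nat^'d. \<forall>k. s $ k \<in> {..r}}"
    by (rule card_vec_box(1)[where A = "\<lambda>_. {..r}"]) simp
qed

text \<open>Minimizing coefficients need not be unique, but the fitted values on \<open>S\<close>
  are, being the projection of the data. As \<open>i\<close> is in \<open>S\<close>, the constant
  coefficient is the fitted value at \<open>i\<close>, so the fallback to \<open>y i\<close> does
  not occur.\<close>

lemma lpr_estimator_eq:
  fixes i :: "nat^'d"
  assumes H: "projection_kernel (\<lambda>s j. mi_power (design n j - design n i) s) {s. mi_order s \<le> r} S H"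
    and "i \<in> S" "S \<subseteq> grid n" and w: "\<And>j. j \<in> grid n \<Longrightarrow> w i j = of_bool (j \<in> S)"
  shows "lpr_estimator n r w y i = clip (\<Sum>j\<in>S. H i j * y j)"
proof -
  let ?J = "{s :: nat^'d. mi_order s \<le> r}"
  define g where "g = (\<lambda>s j. mi_power (design n j - design n i) s)"
  define p where "p a j = (\<Sum>s\<in>?J. a s * g s j)" for a j
  define yh where "yh j = (\<Sum>k\<in>S. H j k * y k)" for j
  note H = H[folded g_def]
  note sym = projection_kernelD(1)[OF H]
  have finS: "finite S" using assms(3) by (rule finite_subset) simp
  \<comment> \<open>In coordinates centred at \<open>design n i\<close>, every monomial except the
    constant one vanishes at \<open>i\<close>.\<close>
  have p_i: "p a i = a 0" for a
  proof -
    have "p a i = (\<Sum>s\<in>?J. if s = 0 then a 0 else 0)"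
      by (auto simp: p_def g_def mi_power_zero intro!: sum.cong)
    also have "\<dots> = a 0"
      by (subst sum.delta) (auto simp: mi_order_def[of 0])
    finally show ?thesis .
  qed
  obtain A where A: "\<And>i j. i \<in> S \<Longrightarrow> j \<in> S \<Longrightarrow> H i j = (\<Sum>t\<in>?J. A i t * g t j)"
    using projection_kernelD(3)[OF H] by metis
  \<comment> \<open>By symmetry \<open>yh\<close> is a combination of rows of \<open>H\<close>, and
    row \<open>k\<close> has the coefficients \<open>A k\<close>; these are the resulting
    coefficients.\<close>
  define ah where "ah t = (\<Sum>k\<in>S. y k * A k t)" for t
  have yh: "yh j = p ah j" if "j \<in> S" for j
  proof -
    have "yh j = (\<Sum>k\<in>S. \<Sum>t\<in>?J. y k * A k t * g t j)"
      unfolding yh_def by (intro sum.cong refl)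
        (simp only: sym[OF that] A[OF _ that] sum_distrib_left sum_distrib_right mult_ac)
    then show ?thesis
      by (subst (asm) sum.swap) (simp add: ah_def p_def sum_distrib_right)
  qed
  have reproduce: "(\<Sum>j\<in>S. H k j * p a j) = p a k" if "k \<in> S" for a k
    by (rule projection_kernel_reproduce[OF H that, where a = a]) (simp add: p_def)
  have orth: "(\<Sum>j\<in>S. (y j - yh j) * p a j) = 0" for a
  proof -
    have "(\<Sum>j\<in>S. yh j * p a j) = (\<Sum>j\<in>S. \<Sum>k\<in>S. y k * (H j k * p a j))"
      by (simp add: yh_def sum_distrib_left sum_distrib_right mult_ac)
    also have "\<dots> = (\<Sum>k\<in>S. y k * (\<Sum>j\<in>S. H k j * p a j))"
      by (subst sum.swap) (auto simp: sum_distrib_left sym intro!: sum.cong)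
    also have "\<dots> = (\<Sum>k\<in>S. y k * p a k)"
      by (intro sum.cong refl) (simp add: reproduce)
    finally show ?thesis by (simp add: left_diff_distrib sum_subtractf)
  qed
  have crit: "lpr_criterion n r w y i a = (\<Sum>j\<in>S. (y j - p a j)\<^sup>2)" for a
  proof -
    have "lpr_criterion n r w y i a = (\<Sum>j\<in>grid n. of_bool (j \<in> S) * (y j - p a j)\<^sup>2)"
      unfolding lpr_criterion_def by (intro sum.cong refl) (simp add: w p_def g_def)
    also have "\<dots> = (\<Sum>j\<in>S. (y j - p a j)\<^sup>2)"
      using assms(3) by (intro sum.mono_neutral_cong_right) auto
    finally show ?thesis .
  qed
  \<comment> \<open>Pythagoras: the residual \<open>y - yh\<close> is orthogonal to every
    polynomial, so the cross terms vanish.\<close>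
  have pyth: "lpr_criterion n r w y i a = lpr_criterion n r w y i ah + (\<Sum>j\<in>S. (p ah j - p a j)\<^sup>2)" for a
  proof -
    have "(y j - p a j)\<^sup>2 = (y j - p ah j)\<^sup>2 + (p ah j - p a j)\<^sup>2
        + 2 * ((y j - yh j) * p ah j) - 2 * ((y j - yh j) * p a j)" if "j \<in> S" for j
      using that by (simp add: yh power2_eq_square algebra_simps)
    then have "(\<Sum>j\<in>S. (y j - p a j)\<^sup>2) = (\<Sum>j\<in>S. (y j - p ah j)\<^sup>2 + (p ah j - p a j)\<^sup>2
        + 2 * ((y j - yh j) * p ah j) - 2 * ((y j - yh j) * p a j))"
      by (intro sum.cong refl)
    then show ?thesis
      by (simp add: crit sum.distrib sum_subtractf orth flip: sum_distrib_left)
  qed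
  have "lpr_criterion n r w y i ah \<le> lpr_criterion n r w y i a" for a
    by (subst (2) pyth) (simp add: sum_nonneg)
  then have arg_min: "is_arg_min (lpr_criterion n r w y i) (\<lambda>_. True) ah"
    by (simp add: is_arg_min_linorder)
  \<comment> \<open>Another minimizer may differ from \<open>ah\<close> as a coefficient vector, but
    its polynomial takes the same values on \<open>S\<close>, in particular at
    \<open>i\<close>.\<close>
  have uniq: "a 0 = ah 0" if "is_arg_min (lpr_criterion n r w y i) (\<lambda>_. True) a" for a
  proof -
    have "(\<Sum>j\<in>S. (p ah j - p a j)\<^sup>2) \<le> 0"
      using that pyth[of a] unfolding is_arg_min_linorder by (smt (verit))
    then have "(\<Sum>j\<in>S. (p ah j - p a j)\<^sup>2) = 0"
      by (meson antisym sum_nonneg zero_le_power2)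
    then have "p ah i = p a i"
      using \<open>i \<in> S\<close> finS by (subst (asm) sum_nonneg_eq_0_iff) auto
    then show ?thesis by (simp add: p_i)
  qed
  have V: "{a 0 | a. is_arg_min (lpr_criterion n r w y i) (\<lambda>_. True) a} = {ah 0}"
  proof (rule antisym)
    show "{a 0 | a. is_arg_min (lpr_criterion n r w y i) (\<lambda>_. True) a} \<subseteq> {ah 0}"
      using uniq by blast
    show "{ah 0} \<subseteq> {a 0 | a. is_arg_min (lpr_criterion n r w y i) (\<lambda>_. True) a}"
      using arg_min by blast
  qed
  have eq: "ah 0 = (\<Sum>j\<in>S. H i j * y j)"
    using yh[OF \<open>i \<in> S\<close>] by (simp add: p_i yh_def)
  have "(THE v. v \<in> {ah 0}) = ah 0" by simp
  then show ?thesis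
    unfolding lpr_estimator_def V Let_def eq[symmetric] by simp
qed

section \<open>Taylor expansion in Holder classes\<close>

text \<open>The coefficients are quantified away, so that sums, products with a coordinate and
  translations need no formula for them.\<close>

definition poly_fun :: "nat \<Rightarrow> (real^'d \<Rightarrow> real) \<Rightarrow> bool" where
  "poly_fun r f \<longleftrightarrow> (\<exists>a. \<forall>v. f v = (\<Sum>t | mi_order t \<le> r. a t * mi_power v t))"

lemma mi_order_0 [simp]: "mi_order 0 = 0"
  by (simp add: mi_order_def)

lemma poly_fun_monom:
  assumes "mi_order s \<le> r"
  shows "poly_fun r (\<lambda>v. mi_power v s)"
proof -
  have "mi_power v s = (\<Sum>t | mi_order t \<le> r. (if t = s then 1 else 0) * mi_power v t)" for v
  proof -
    have "(\<Sum>t | mi_order t \<le> r. (if t = s then 1 else 0) * mi_power v t)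
        = (\<Sum>t | mi_order t \<le> r. if t = s then mi_power v t else 0)"
      by (intro sum.cong) auto
    also have "\<dots> = mi_power v s"
      using assms by (subst sum.delta) auto
    finally show ?thesis ..
  qed
  then show ?thesis unfolding poly_fun_def by (intro exI[of _ "\<lambda>t. if t = s then 1 else 0"] allI)
qed

lemma poly_funE:
  assumes "poly_fun r f"
  obtains a where "\<And>v. f v = (\<Sum>t | mi_order t \<le> r. a t * mi_power v t)"
proof -
  from assms obtain a where "\<forall>v. f v = (\<Sum>t | mi_order t \<le> r. a t * mi_power v t)"
    unfolding poly_fun_def ..
  then show ?thesis by (intro that[of a]) simp
qed

lemma poly_fun_zero: "poly_fun r (\<lambda>_. 0)"
  unfolding poly_fun_def by (intro exI[of _ "\<lambda>_. 0"]) simp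

lemma poly_fun_add:
  assumes "poly_fun r f" "poly_fun r g"
  shows "poly_fun r (\<lambda>v. f v + g v)"
proof -
  obtain a where a: "\<And>v. f v = (\<Sum>t | mi_order t \<le> r. a t * mi_power v t)"
    using assms(1) by (rule poly_funE) blast
  obtain b where b: "\<And>v. g v = (\<Sum>t | mi_order t \<le> r. b t * mi_power v t)"
    using assms(2) by (rule poly_funE) blast
  show ?thesis unfolding poly_fun_def a b
    by (intro exI[of _ "\<lambda>t. a t + b t"]) (simp add: distrib_right sum.distrib)
qed

lemma poly_fun_cmult:
  assumes "poly_fun r f"
  shows "poly_fun r (\<lambda>v. c * f v)"
proof -
  obtain a where a: "\<And>v. f v = (\<Sum>t | mi_order t \<le> r. a t * mi_power v t)"
    using assms by (rule poly_funE) blast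
  show ?thesis unfolding poly_fun_def a
    by (intro exI[of _ "\<lambda>t. c * a t"]) (simp add: sum_distrib_left mult.assoc)
qed

lemma poly_fun_sum:
  assumes "finite A" "\<And>x. x \<in> A \<Longrightarrow> poly_fun r (f x)"
  shows "poly_fun r (\<lambda>v. \<Sum>x\<in>A. f x v)"
  using assms by (induction A rule: finite_induct) (auto intro: poly_fun_zero poly_fun_add)

lemma mi_order_add_axis: "mi_order (s + axis k 1) = Suc (mi_order s)"
  by (simp add: mi_order_def sum.distrib axis_def)

lemma mi_power_add_axis: "mi_power v (s + axis k 1) = v $ k * mi_power v s"
proof -
  have "mi_power v (s + axis k 1) = (\<Prod>l\<in>UNIV. v $ l ^ (s $ l) * (if l = k then v $ l else 1))"
    unfolding mi_power_def by (intro prod.cong) (auto simp: axis_def)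
  also have "\<dots> = mi_power v s * v $ k"
    by (simp add: prod.distrib mi_power_def)
  finally show ?thesis by simp
qed

lemmas add_axis_simps = mi_order_add_axis mi_order_add_axis[unfolded One_nat_def]
  mi_power_add_axis mi_power_add_axis[unfolded One_nat_def]

lemma poly_fun_mult_component:
  assumes "poly_fun r f"
  shows "poly_fun (Suc r) (\<lambda>v. v $ k * f v)"
proof -
  obtain a where a: "\<And>v. f v = (\<Sum>t | mi_order t \<le> r. a t * mi_power v t)"
    using assms by (rule poly_funE) blast
  have "(\<lambda>v. v $ k * f v) = (\<lambda>v. \<Sum>t | mi_order t \<le> r. a t * mi_power v (t + axis k 1))"
    by (simp add: a sum_distrib_left add_axis_simps mult.left_commute)
  moreover have "poly_fun (Suc r) (\<lambda>v. \<Sum>t | mi_order t \<le> r. a t * mi_power v (t + axis k 1))"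
    by (intro poly_fun_sum poly_fun_cmult poly_fun_monom) (auto simp: mi_order_add_axis[unfolded One_nat_def])
  ultimately show ?thesis by (simp only:)
qed

lemma poly_fun_mono:
  assumes "poly_fun r f" "r \<le> r'"
  shows "poly_fun r' f"
proof -
  obtain a where a: "\<And>v. f v = (\<Sum>t | mi_order t \<le> r. a t * mi_power v t)"
    using assms(1) by (rule poly_funE) blast
  have "poly_fun r' (\<lambda>v. \<Sum>t | mi_order t \<le> r. a t * mi_power v t)"
    using assms(2) by (auto intro!: poly_fun_sum poly_fun_cmult poly_fun_monom)
  then show ?thesis by (simp add: a[abs_def])
qed

text \<open>Fits centred at different pixels use the same polynomial space. Induction on the order
  splits off one linear factor \<open>v $ k - z $ k\<close>, which raises the degree by at most
  one.\<close>

lemma poly_fun_shift_monom: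
  assumes "mi_order s \<le> r"
  shows "poly_fun r (\<lambda>v. mi_power (v - z) s)"
proof -
  have "mi_order s = m \<Longrightarrow> poly_fun m (\<lambda>v. mi_power (v - z) s)" for m
  proof (induction m arbitrary: s)
    case 0
    then have "s = 0" by (simp add: mi_order_def vec_eq_iff)
    then show ?case
      using poly_fun_monom[of 0 0] by simp
  next
    case (Suc m)
    then obtain k where k: "s $ k > 0"
      unfolding mi_order_def by (metis gr0I nat.distinct(1) sum.neutral)
    \<comment> \<open>This subtraction truncates componentwise, but is exact because
      \<open>s $ k\<close> is positive.\<close>
    define t where "t = s - axis k 1"
    have s: "s = t + axis k 1"
      using k by (auto simp: t_def vec_eq_iff axis_def)
    with Suc.prems have t: "mi_order t = m" by (simp add: add_axis_simps)
    have "mi_power (v - z) s = v $ k * mi_power (v - z) t + (- z $ k) * mi_power (v - z) t" for v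
      by (simp add: s add_axis_simps left_diff_distrib)
    moreover have "poly_fun (Suc m) (\<lambda>v. v $ k * mi_power (v - z) t + (- z $ k) * mi_power (v - z) t)"
      by (intro poly_fun_add poly_fun_mult_component poly_fun_cmult[of "Suc m"] Suc.IH t
          poly_fun_mono[OF Suc.IH[OF t]]) auto
    ultimately show ?case by presburger
  qed
  then show ?thesis using assms poly_fun_mono by blast
qed

section \<open>Directional derivatives, Taylor expansion and Lipschitz bounds\<close>

text \<open>The \<open>k\<close>-fold derivative of \<open>D s\<close> in direction
  \<open>v\<close>, as nested sums over coordinates. Repeated mixed partials stay separate terms, so
  no multinomial coefficients arise.\<close>

primrec dir_deriv :: "(nat^'d \<Rightarrow> real^'d \<Rightarrow> real) \<Rightarrow> real^'d \<Rightarrow> nat \<Rightarrow> nat^'d \<Rightarrow> real^'d \<Rightarrow> real" where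
  "dir_deriv D v 0 s x = D s x"
| "dir_deriv D v (Suc k) s x = (\<Sum>l\<in>UNIV. v $ l * dir_deriv D v k (s + axis l 1) x)"

lemma cube_derivsD:
  assumes "cube_derivs m g D"
  shows "x \<in> unit_cube \<Longrightarrow> D 0 x = g x"
    and "mi_order s < m \<Longrightarrow> x \<in> unit_cube \<Longrightarrow>
      (D s has_derivative (\<lambda>v. \<Sum>k\<in>UNIV. v $ k * D (s + axis k 1) x)) (at x within unit_cube)"
proof -
  show "D 0 x = g x" if "x \<in> unit_cube"
    using conjunct1[OF assms[unfolded cube_derivs_def]] that by (rule bspec)
  show "(D s has_derivative (\<lambda>v. \<Sum>k\<in>UNIV. v $ k * D (s + axis k 1) x)) (at x within unit_cube)"
    if "mi_order s < m" "x \<in> unit_cube"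
    by (rule bspec[OF mp[OF spec[OF conjunct2[OF assms[unfolded cube_derivs_def]]]] that(2)]) (rule that(1))
qed

text \<open>In the open cube the derivative within the closed cube is an ordinary one, so the chain
  rule along a line gives the two-sided derivatives that Maclaurin's formula asks for.\<close>

lemma dir_deriv_has_derivative:
  fixes x v :: "real^'d"
  assumes D: "cube_derivs m g D" and "mi_order s + k < m" "x + t *\<^sub>R v \<in> box 0 One"
  shows "((\<lambda>t. dir_deriv D v k s (x + t *\<^sub>R v)) has_real_derivative
          dir_deriv D v (Suc k) s (x + t *\<^sub>R v)) (at t)"
  using assms(2)
proof (induction k arbitrary: s)
  case 0
  let ?y = "x + t *\<^sub>R v"
  have y: "?y \<in> interior unit_cube"
    using assms(3) by (simp add: interior_cbox)
  then have "?y \<in> unit_cube" using interior_subset by blast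
  moreover have "mi_order s < m" using 0 by simp
  ultimately have "(D s has_derivative (\<lambda>v. \<Sum>k\<in>UNIV. v $ k * D (s + axis k 1) ?y)) (at ?y within unit_cube)"
    by (rule cube_derivsD(2)[OF D, rotated])
  then have "(D s has_derivative (\<lambda>v. \<Sum>k\<in>UNIV. v $ k * D (s + axis k 1) ?y)) (at ?y)"
    by (simp only: at_within_interior[OF y])
  moreover have "((\<lambda>t. x + t *\<^sub>R v) has_derivative (\<lambda>t. t *\<^sub>R v)) (at t)"
    by (auto intro!: derivative_eq_intros)
  ultimately have "((\<lambda>t. D s (x + t *\<^sub>R v)) has_derivative
      (\<lambda>u. \<Sum>k\<in>UNIV. (u *\<^sub>R v) $ k * D (s + axis k 1) ?y)) (at t)"
    by (rule has_derivative_compose[rotated])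
  then show ?case
    unfolding has_field_derivative_def dir_deriv.simps
    by (rule has_derivative_eq_rhs)
      (simp add: sum_distrib_left sum_distrib_right fun_eq_iff mult_ac del: One_nat_def)
next
  case (Suc k)
  have "((\<lambda>t. dir_deriv D v k (s + axis l 1) (x + t *\<^sub>R v)) has_real_derivative
      dir_deriv D v (Suc k) (s + axis l 1) (x + t *\<^sub>R v)) (at t)" for l
    using Suc.prems by (intro Suc.IH) (simp add: add_axis_simps)
  then have "((\<lambda>t. \<Sum>l\<in>UNIV. v $ l * dir_deriv D v k (s + axis l 1) (x + t *\<^sub>R v)) has_real_derivative
      (\<Sum>l\<in>UNIV. v $ l * dir_deriv D v (Suc k) (s + axis l 1) (x + t *\<^sub>R v))) (at t)"
    by (intro DERIV_sum DERIV_cmult)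
  then show ?case by (simp only: dir_deriv.simps)
qed

lemma poly_fun_dir_deriv: "poly_fun k (\<lambda>v. dir_deriv D v k s x)"
proof (induction k arbitrary: s)
  case 0
  have "poly_fun 0 (\<lambda>v :: real^'a. D s x * mi_power v 0)"
    by (intro poly_fun_cmult poly_fun_monom) simp
  then show ?case by simp
next
  case (Suc k)
  then show ?case
    by (auto intro!: poly_fun_sum poly_fun_mult_component)
qed

text \<open>Each of the \<open>k\<close> nested sums has \<open>CARD('d)\<close> terms, with a
  factor of modulus at most \<open>infnorm v\<close>.\<close>

lemma dir_deriv_diff_le:
  fixes v :: "real^'d"
  assumes "\<And>s'. mi_order s' = mi_order s + k \<Longrightarrow> \<bar>D s' y - D s' x\<bar> \<le> E"
  shows "\<bar>dir_deriv D v k s y - dir_deriv D v k s x\<bar> \<le> (real CARD('d) * infnorm v) ^ k * E"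
  using assms
proof (induction k arbitrary: s)
  case (Suc k)
  let ?d = "\<lambda>l. dir_deriv D v k (s + axis l 1) y - dir_deriv D v k (s + axis l 1) x"
  have IH: "\<bar>?d l\<bar> \<le> (real CARD('d) * infnorm v) ^ k * E" for l
    using Suc.prems by (intro Suc.IH) (simp add: add_axis_simps)
  have "\<bar>dir_deriv D v (Suc k) s y - dir_deriv D v (Suc k) s x\<bar> = \<bar>\<Sum>l\<in>UNIV. v $ l * ?d l\<bar>"
    by (simp add: right_diff_distrib sum_subtractf)
  also have "\<dots> \<le> (\<Sum>l\<in>UNIV. \<bar>v $ l * ?d l\<bar>)" by (rule sum_abs)
  also have "\<dots> \<le> (\<Sum>l\<in>(UNIV :: 'd set). infnorm v * ((real CARD('d) * infnorm v) ^ k * E))"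
    unfolding abs_mult
    by (intro sum_mono mult_mono IH component_le_infnorm_cart infnorm_pos_le abs_ge_zero)
  finally show ?case by (simp add: mult_ac)
qed simp

text \<open>Maclaurin's formula along the segment from \<open>x\<close> to \<open>y\<close> leaves
  the derivative of order \<open>sfloor \<alpha>\<close> at an intermediate point. Moving it to
  \<open>x\<close> costs a Holder increment, which supplies the missing power of the
  distance.\<close>

lemma holder_taylor:
  fixes x :: "real^'d"
  assumes "\<alpha> \<ge> 1" "C0 > 0" "g \<in> holder_class \<alpha> C0" "x \<in> box 0 One"
  obtains P where "poly_fun (sfloor \<alpha>) P"
    "\<And>y. y \<in> box 0 One \<Longrightarrow>
      \<bar>g y - P (y - x)\<bar> \<le> real CARD('d) ^ sfloor \<alpha> * C0 * infnorm (y - x) powr \<alpha>"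
proof -
  define m where "m = sfloor \<alpha>"
  have m: "real m < \<alpha>"
    using assms(1) unfolding m_def sfloor_def by linarith
  obtain D where D: "cube_derivs m g D"
    and hol: "\<And>s x x'. mi_order s = m \<Longrightarrow> x \<in> unit_cube \<Longrightarrow> x' \<in> unit_cube \<Longrightarrow>
      \<bar>D s x - D s x'\<bar> \<le> C0 * infnorm (x - x') powr (\<alpha> - real m)"
    using assms(3) unfolding holder_class_def m_def by auto
  have D0: "D 0 z = g z" if "z \<in> box 0 One" for z
    using box_subset_cbox that by (intro cube_derivsD(1)[OF D]) blast
  define P where "P v = (\<Sum>k\<le>m. inverse (fact k) * dir_deriv D v k 0 x)" for v
  have "poly_fun m P"
    unfolding P_def by (auto intro!: poly_fun_sum poly_fun_cmult intro: poly_fun_mono poly_fun_dir_deriv)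
  moreover have "\<bar>g y - P (y - x)\<bar> \<le> real CARD('d) ^ m * C0 * infnorm (y - x) powr \<alpha>"
    if y: "y \<in> box 0 One" for y
  proof -
    define v where "v = y - x"
    have seg: "x + t *\<^sub>R v \<in> box 0 One" if "0 \<le> t" "t \<le> 1" for t
    proof -
      have "(1 - t) *\<^sub>R x + t *\<^sub>R y \<in> box 0 One"
        using convexD[OF convex_box(2) assms(4) y, of "1 - t" t] that by simp
      then show ?thesis by (simp add: v_def algebra_simps)
    qed
    \<comment> \<open>Maclaurin's formula needs a positive order. For \<open>m = 0\<close>, the
      choice \<open>t = 1\<close> makes the right side the plain difference
      \<open>g y - g x\<close>.\<close>
    have "\<exists>t. 0 \<le> t \<and> t \<le> 1 \<and> g y - P v = inverse (fact m) * (dir_deriv D v m 0 (x + t *\<^sub>R v) - dir_deriv D v m 0 x)"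
    proof (cases "m = 0")
      case True
      then show ?thesis
        by (intro exI[of _ 1]) (simp add: P_def D0 assms(4) y v_def)
    next
      case False
      have "\<exists>t>0. t < 1 \<and> dir_deriv D v 0 0 (x + 1 *\<^sub>R v) =
          (\<Sum>k<m. dir_deriv D v k 0 (x + 0 *\<^sub>R v) / fact k * 1 ^ k)
            + dir_deriv D v m 0 (x + t *\<^sub>R v) / fact m * 1 ^ m"
        using False D
        by (intro Maclaurin[where f = "\<lambda>t. dir_deriv D v 0 0 (x + t *\<^sub>R v)"
              and diff = "\<lambda>k t. dir_deriv D v k 0 (x + t *\<^sub>R v)"])
          (auto intro!: dir_deriv_has_derivative seg simp del: dir_deriv.simps)
      then obtain t where t: "0 < t" "t < 1" "g y = (\<Sum>k<m. dir_deriv D v k 0 x / fact k)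
            + dir_deriv D v m 0 (x + t *\<^sub>R v) / fact m"
        using D0[OF y] by (auto simp: v_def)
      moreover have "P v = (\<Sum>k<m. dir_deriv D v k 0 x / fact k) + dir_deriv D v m 0 x / fact m"
        unfolding P_def by (simp add: field_simps flip: lessThan_Suc_atMost)
      ultimately show ?thesis
        by (intro exI[of _ t]) (simp add: field_simps)
    qed
    then obtain t where t: "0 \<le> t" "t \<le> 1" and
      eq: "g y - P v = inverse (fact m) * (dir_deriv D v m 0 (x + t *\<^sub>R v) - dir_deriv D v m 0 x)"
      by blast
    have "\<bar>D s (x + t *\<^sub>R v) - D s x\<bar> \<le> C0 * infnorm v powr (\<alpha> - m)" if "mi_order s = m" for s
    proof -
      have "\<bar>D s (x + t *\<^sub>R v) - D s x\<bar> \<le> C0 * infnorm (x + t *\<^sub>R v - x) powr (\<alpha> - m)"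
        using seg[OF t] assms(4) box_subset_cbox by (intro hol that) blast+
      also have "infnorm (x + t *\<^sub>R v - x) = t * infnorm v"
        using t by (simp add: infnorm_mul)
      also have "C0 * (t * infnorm v) powr (\<alpha> - m) \<le> C0 * infnorm v powr (\<alpha> - m)"
        using assms(2) m t infnorm_pos_le[of v]
        by (intro mult_left_mono powr_mono2 mult_left_le_one_le mult_nonneg_nonneg) simp_all
      finally show ?thesis .
    qed
    then have "\<bar>dir_deriv D v m 0 (x + t *\<^sub>R v) - dir_deriv D v m 0 x\<bar>
        \<le> (real CARD('d) * infnorm v) ^ m * (C0 * infnorm v powr (\<alpha> - m))"
      by (intro dir_deriv_diff_le) simp
    also have "\<dots> = real CARD('d) ^ m * C0 * (infnorm v ^ m * infnorm v powr (\<alpha> - m))"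
      by (simp add: power_mult_distrib mult_ac)
    also have "infnorm v ^ m * infnorm v powr (\<alpha> - m) = infnorm v powr \<alpha>"
    proof (cases "infnorm v = 0")
      case False
      then show ?thesis
        using infnorm_pos_le[of v] by (simp add: powr_realpow[symmetric] powr_add[symmetric])
    qed (use m in simp)
    finally have *: "\<bar>dir_deriv D v m 0 (x + t *\<^sub>R v) - dir_deriv D v m 0 x\<bar>
        \<le> real CARD('d) ^ m * C0 * infnorm v powr \<alpha>" .
    have "\<bar>g y - P v\<bar> = inverse (fact m) * \<bar>dir_deriv D v m 0 (x + t *\<^sub>R v) - dir_deriv D v m 0 x\<bar>"
      by (simp add: eq abs_mult)
    also have "\<dots> \<le> 1 * (real CARD('d) ^ m * C0 * infnorm v powr \<alpha>)"
      by (intro mult_mono *) (auto simp: inverse_le_1_iff)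
    finally show ?thesis by (simp add: v_def)
  qed
  ultimately show ?thesis
    using that unfolding m_def by blast
qed

text \<open>If \<open>sfloor \<alpha>\<close> is positive, the first derivatives are bounded and the
  mean value inequality on the convex cube applies; otherwise \<open>\<alpha> = 1\<close> and the
  Holder condition is itself Lipschitz. The factor \<open>CARD('d)\<close> counts partial
  derivatives, and its square root passes from the Euclidean to the sup norm.\<close>

lemma holder_lipschitz:
  fixes g :: "real^'d \<Rightarrow> real"
  assumes "\<alpha> \<ge> 1" "C0 > 0" "g \<in> holder_class \<alpha> C0" "x \<in> unit_cube" "y \<in> unit_cube"
  shows "\<bar>g x - g y\<bar> \<le> C0 * real CARD('d) * sqrt (real CARD('d)) * infnorm (x - y)"
proof -
  obtain D where D: "cube_derivs (sfloor \<alpha>) g D"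
    and bd: "\<And>s x. 1 \<le> mi_order s \<Longrightarrow> mi_order s \<le> sfloor \<alpha> \<Longrightarrow> x \<in> unit_cube \<Longrightarrow> \<bar>D s x\<bar> \<le> C0"
    and hol: "\<And>s x x'. mi_order s = sfloor \<alpha> \<Longrightarrow> x \<in> unit_cube \<Longrightarrow> x' \<in> unit_cube \<Longrightarrow>
      \<bar>D s x - D s x'\<bar> \<le> C0 * infnorm (x - x') powr (\<alpha> - real (sfloor \<alpha>))"
    using assms(3) unfolding holder_class_def by auto
  have D0: "D 0 z = g z" if "z \<in> unit_cube" for z
    using that by (rule cube_derivsD(1)[OF D])
  have d1: "1 \<le> real CARD('d)"
    by (simp add: Suc_leI)
  show ?thesis
  proof (cases "sfloor \<alpha> = 0")
    case True
    then have "\<alpha> = 1" using assms(1) unfolding sfloor_def by linarith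
    then have "\<bar>g x - g y\<bar> \<le> C0 * infnorm (x - y)"
      using hol[of 0 x y] True assms(4,5) by (simp add: D0 infnorm_pos_le)
    also have "\<dots> \<le> (C0 * real CARD('d) * sqrt (real CARD('d))) * infnorm (x - y)"
    proof (rule mult_right_mono)
      have "1 * 1 \<le> real CARD('d) * sqrt (real CARD('d))"
        using d1 by (intro mult_mono) auto
      then show "C0 \<le> C0 * real CARD('d) * sqrt (real CARD('d))"
        using assms(2) by (simp add: mult.assoc)
    qed (rule infnorm_pos_le)
    finally show ?thesis .
  next
    case False
    let ?D' = "\<lambda>x v. \<Sum>k\<in>UNIV. v $ k * D (0 + axis k 1) x"
    have "norm (D 0 x - D 0 y) \<le> (C0 * real CARD('d)) * norm (x - y)"
    proof (rule differentiable_bound[where S = unit_cube and f' = ?D'])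
      show "(D 0 has_derivative ?D' z) (at z within unit_cube)" if "z \<in> unit_cube" for z
        by (rule cube_derivsD(2)[OF D]) (use False that in simp_all)
      show "onorm (?D' z) \<le> C0 * real CARD('d)" if "z \<in> unit_cube" for z
      proof (rule onorm_le)
        fix v :: "real^'d"
        have "norm (?D' z v) \<le> (\<Sum>k\<in>UNIV. \<bar>v $ k * D (0 + axis k 1) z\<bar>)"
          unfolding real_norm_def by (rule sum_abs)
        also have "\<dots> \<le> (\<Sum>k\<in>(UNIV :: 'd set). norm v * C0)"
        proof (rule sum_mono)
          fix k :: 'd
          have "\<bar>D (0 + axis k 1) z\<bar> \<le> C0"
            using False that by (intro bd) (simp_all only: mi_order_add_axis mi_order_0)
          then show "\<bar>v $ k * D (0 + axis k 1) z\<bar> \<le> norm v * C0"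
            unfolding abs_mult by (intro mult_mono component_le_norm_cart) auto
        qed
        finally show "norm (?D' z v) \<le> C0 * real CARD('d) * norm v"
          by (simp add: mult_ac)
      qed
    qed (use assms in \<open>auto\<close>)
    also have "\<dots> \<le> (C0 * real CARD('d)) * (sqrt (real CARD('d)) * infnorm (x - y))"
      using norm_le_infnorm[of "x - y"] assms(2) by (intro mult_left_mono) auto
    finally show ?thesis
      by (simp add: D0 assms(4,5) mult.assoc)
  qed
qed

section \<open>Noise\<close>

text \<open>Bias-variance decomposition of a linear smoother with bias \<open>c\<close>: on
  expanding the square, zero mean and uncorrelatedness remove the cross terms.\<close>

lemma nn_integral_affine_noise:
  assumes "uncorrelated_noise M I \<epsilon> \<sigma>" "S \<subseteq> I" "finite S"
  shows "(\<integral>\<^sup>+\<omega>. ennreal ((c + (\<Sum>j\<in>S. b j * \<epsilon> j \<omega>))\<^sup>2) \<partial>M)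
    = ennreal (c\<^sup>2 + \<sigma>\<^sup>2 * (\<Sum>j\<in>S. (b j)\<^sup>2))"
proof -
  interpret prob_space M
    using assms(1) by (simp add: uncorrelated_noise_def)
  have meas [measurable]: "\<epsilon> j \<in> borel_measurable M" and sq: "integrable M (\<lambda>\<omega>. (\<epsilon> j \<omega>)\<^sup>2)"
    and E0: "expectation (\<epsilon> j) = 0" and V: "variance (\<epsilon> j) = \<sigma>\<^sup>2" if "j \<in> S" for j
    using assms(1,2) that by (auto simp: uncorrelated_noise_def)
  have C: "expectation (\<lambda>\<omega>. (\<epsilon> j \<omega> - expectation (\<epsilon> j)) * (\<epsilon> k \<omega> - expectation (\<epsilon> k))) = 0"
    if "j \<in> S" "k \<in> S" "j \<noteq> k" for j k
    using assms(1,2) that by (auto simp: uncorrelated_noise_def)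
  have int1: "integrable M (\<epsilon> j)" if "j \<in> S" for j
    using square_integrable_imp_integrable[OF meas sq] that by blast
  \<comment> \<open>Products are dominated by sums of squares, so square integrability carries over
    to them.\<close>
  have int2: "integrable M (\<lambda>\<omega>. \<epsilon> j \<omega> * \<epsilon> k \<omega>)" if "j \<in> S" "k \<in> S" for j k
  proof (rule Bochner_Integration.integrable_bound)
    show "integrable M (\<lambda>\<omega>. (\<epsilon> j \<omega>)\<^sup>2 + (\<epsilon> k \<omega>)\<^sup>2)"
      by (intro Bochner_Integration.integrable_add sq that)
    show "(\<lambda>\<omega>. \<epsilon> j \<omega> * \<epsilon> k \<omega>) \<in> borel_measurable M"
      by (intro borel_measurable_times meas that)
    have "\<bar>x * y\<bar> \<le> \<bar>x\<^sup>2 + y\<^sup>2\<bar>" for x y :: real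
    proof -
      have "0 \<le> \<bar>x\<bar> * \<bar>y\<bar>" by simp
      then show ?thesis
        using sum_squares_bound[of "\<bar>x\<bar>" "\<bar>y\<bar>"] unfolding abs_mult mult.assoc power2_abs by linarith
    qed
    then show "AE \<omega> in M. norm (\<epsilon> j \<omega> * \<epsilon> k \<omega>) \<le> norm ((\<epsilon> j \<omega>)\<^sup>2 + (\<epsilon> k \<omega>)\<^sup>2)"
      by simp
  qed
  have E2: "expectation (\<lambda>\<omega>. \<epsilon> j \<omega> * \<epsilon> k \<omega>) = (if j = k then \<sigma>\<^sup>2 else 0)" if "j \<in> S" "k \<in> S" for j k
    using V[OF that(1)] C[OF that] E0 that by (auto simp: power2_eq_square)
  have expand: "(c + (\<Sum>j\<in>S. b j * \<epsilon> j \<omega>))\<^sup>2 = c\<^sup>2 + ((\<Sum>j\<in>S. 2 * c * b j * \<epsilon> j \<omega>)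
      + (\<Sum>j\<in>S. \<Sum>k\<in>S. b j * b k * (\<epsilon> j \<omega> * \<epsilon> k \<omega>)))" for \<omega>
  proof -
    have "(\<Sum>j\<in>S. b j * \<epsilon> j \<omega>)\<^sup>2 = (\<Sum>j\<in>S. \<Sum>k\<in>S. b j * b k * (\<epsilon> j \<omega> * \<epsilon> k \<omega>))"
      unfolding power2_eq_square sum_product by (simp only: mult_ac)
    moreover have "2 * c * (\<Sum>j\<in>S. b j * \<epsilon> j \<omega>) = (\<Sum>j\<in>S. 2 * c * b j * \<epsilon> j \<omega>)"
      by (simp only: sum_distrib_left mult_ac)
    ultimately show ?thesis by (simp add: power2_sum)
  qed
  have i1: "integrable M (\<lambda>\<omega>. \<Sum>j\<in>S. 2 * c * b j * \<epsilon> j \<omega>)"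
    by (intro Bochner_Integration.integrable_sum integrable_mult_right int1)
  have i2: "integrable M (\<lambda>\<omega>. \<Sum>j\<in>S. \<Sum>k\<in>S. b j * b k * (\<epsilon> j \<omega> * \<epsilon> k \<omega>))"
    by (intro Bochner_Integration.integrable_sum integrable_mult_right int2)
  have e1: "expectation (\<lambda>\<omega>. \<Sum>j\<in>S. 2 * c * b j * \<epsilon> j \<omega>) = 0"
    by (subst Bochner_Integration.integral_sum) (auto intro: int1 simp: E0)
  have "expectation (\<lambda>\<omega>. \<Sum>j\<in>S. \<Sum>k\<in>S. b j * b k * (\<epsilon> j \<omega> * \<epsilon> k \<omega>))
      = (\<Sum>j\<in>S. \<Sum>k\<in>S. b j * b k * (if j = k then \<sigma>\<^sup>2 else 0))"
    using int2 by (simp add: Bochner_Integration.integral_sum Bochner_Integration.integrable_sum E2 cong: sum.cong)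
  also have "\<dots> = \<sigma>\<^sup>2 * (\<Sum>j\<in>S. (b j)\<^sup>2)"
    using assms(3) by (simp add: if_distrib sum.delta sum_distrib_left power2_eq_square mult_ac cong: if_cong)
  finally have e2: "expectation (\<lambda>\<omega>. \<Sum>j\<in>S. \<Sum>k\<in>S. b j * b k * (\<epsilon> j \<omega> * \<epsilon> k \<omega>)) = \<sigma>\<^sup>2 * (\<Sum>j\<in>S. (b j)\<^sup>2)" .
  have int: "integrable M (\<lambda>\<omega>. (c + (\<Sum>j\<in>S. b j * \<epsilon> j \<omega>))\<^sup>2)"
    unfolding expand by (intro Bochner_Integration.integrable_add i1 i2) simp
  have "(\<integral>\<^sup>+\<omega>. ennreal ((c + (\<Sum>j\<in>S. b j * \<epsilon> j \<omega>))\<^sup>2) \<partial>M)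
      = ennreal (expectation (\<lambda>\<omega>. (c + (\<Sum>j\<in>S. b j * \<epsilon> j \<omega>))\<^sup>2))"
    by (intro nn_integral_eq_integral int) simp
  also have "expectation (\<lambda>\<omega>. (c + (\<Sum>j\<in>S. b j * \<epsilon> j \<omega>))\<^sup>2) = c\<^sup>2 + \<sigma>\<^sup>2 * (\<Sum>j\<in>S. (b j)\<^sup>2)"
    unfolding expand using i1 i2 by (simp add: e1 e2 prob_space)
  finally show ?thesis .
qed

text \<open>Union bound over the pixels, applied to the complements of the events in the
  hypothesis.\<close>

lemma emeasure_noise_exceeds:
  fixes \<epsilon> :: "'i \<Rightarrow> 'a \<Rightarrow> real"
  assumes "prob_space M" "finite I" "\<And>i. i \<in> I \<Longrightarrow> \<epsilon> i \<in> borel_measurable M"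
    and "\<And>i. i \<in> I \<Longrightarrow> measure M {\<omega> \<in> space M. \<bar>\<epsilon> i \<omega>\<bar> \<le> \<tau>} \<ge> 1 - q" "0 \<le> q"
  shows "{\<omega> \<in> space M. \<exists>i\<in>I. \<bar>\<epsilon> i \<omega>\<bar> > \<tau>} \<in> sets M"
    and "emeasure M {\<omega> \<in> space M. \<exists>i\<in>I. \<bar>\<epsilon> i \<omega>\<bar> > \<tau>} \<le> ennreal (real (card I) * q)"
proof -
  interpret prob_space M by fact
  have eq: "{\<omega> \<in> space M. \<exists>i\<in>I. \<bar>\<epsilon> i \<omega>\<bar> > \<tau>} = (\<Union>i\<in>I. {\<omega> \<in> space M. \<bar>\<epsilon> i \<omega>\<bar> > \<tau>})"
    by auto
  have [measurable]: "{\<omega> \<in> space M. \<bar>\<epsilon> i \<omega>\<bar> > \<tau>} \<in> sets M" if "i \<in> I" for i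
  proof -
    have [measurable]: "\<epsilon> i \<in> borel_measurable M" using assms(3) that .
    show ?thesis by simp
  qed
  show "{\<omega> \<in> space M. \<exists>i\<in>I. \<bar>\<epsilon> i \<omega>\<bar> > \<tau>} \<in> sets M"
    unfolding eq using assms(2) by (intro sets.finite_UN) auto
  have "prob {\<omega> \<in> space M. \<bar>\<epsilon> i \<omega>\<bar> > \<tau>} \<le> q" if "i \<in> I" for i
  proof -
    have "{\<omega> \<in> space M. \<bar>\<epsilon> i \<omega>\<bar> \<le> \<tau>} = space M - {\<omega> \<in> space M. \<bar>\<epsilon> i \<omega>\<bar> > \<tau>}"
      by (auto simp: not_less)
    then have "prob {\<omega> \<in> space M. \<bar>\<epsilon> i \<omega>\<bar> \<le> \<tau>} = 1 - prob {\<omega> \<in> space M. \<bar>\<epsilon> i \<omega>\<bar> > \<tau>}"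
      using that by (simp add: prob_compl)
    then show ?thesis using assms(4)[OF that] by linarith
  qed
  then have "(\<Sum>i\<in>I. prob {\<omega> \<in> space M. \<bar>\<epsilon> i \<omega>\<bar> > \<tau>}) \<le> real (card I) * q"
    using sum_bounded_above[of I _ q] by simp
  moreover have "prob {\<omega> \<in> space M. \<exists>i\<in>I. \<bar>\<epsilon> i \<omega>\<bar> > \<tau>} \<le> (\<Sum>i\<in>I. prob {\<omega> \<in> space M. \<bar>\<epsilon> i \<omega>\<bar> > \<tau>})"
    unfolding eq by (intro finite_measure_subadditive_finite assms(2)) auto
  ultimately show "emeasure M {\<omega> \<in> space M. \<exists>i\<in>I. \<bar>\<epsilon> i \<omega>\<bar> > \<tau>} \<le> ennreal (real (card I) * q)"
    unfolding emeasure_eq_measure by (intro ennreal_leI) linarith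
qed

section \<open>Windows and leverages\<close>

lemma infnorm_cart_le:
  fixes x :: "real^'d"
  assumes "\<And>k. \<bar>x $ k\<bar> \<le> c"
  shows "infnorm x \<le> c"
  unfolding infnorm_Max using assms
  by (intro Max.boundedI) (auto simp: Basis_vec_def inner_axis)

text \<open>\<open>One\<close> is the sum of the basis; this evaluates its coordinates and so
  reduces membership in the cube to coordinatewise inequalities.\<close>

lemma sum_Basis_component [simp]: "(\<Sum>b\<in>Basis. (b :: real^'d) $ k) = 1"
proof -
  have k: "(axis k 1 :: real^'d) \<in> Basis"
    by (simp add: axis_in_Basis_iff)
  have "(\<Sum>b\<in>Basis. (b :: real^'d) $ k) = (\<Sum>b\<in>Basis. if b = (axis k 1 :: real^'d) then 1 else 0)"
    using k by (intro sum.cong refl) (simp add: cart_eq_inner_axis inner_Basis)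
  then show ?thesis using k by simp
qed

lemma design_in_box:
  assumes "i \<in> grid n"
  shows "design n i \<in> box 0 One"
proof -
  have "0 < design n i $ k \<and> design n i $ k < 1" for k
  proof -
    have "1 \<le> real (i $ k)" "real (i $ k) \<le> real n"
      using assms by (auto simp: grid_def of_nat_le_iff[of 1, simplified])
    then show ?thesis by (simp add: design_def divide_simps)
  qed
  then show ?thesis
    by (simp add: mem_box_cart)
qed

lemma design_diff: "(design n i - design n j) $ k = (real (i $ k) - real (j $ k)) / real n"
  by (simp add: design_def diff_divide_distrib)

lemma clip_sq_le:
  assumes "0 \<le> v" "v \<le> 1"
  shows "(clip u - v)\<^sup>2 \<le> (u - v)\<^sup>2" "(clip u - v)\<^sup>2 \<le> 1"
proof -
  have "\<bar>clip u - v\<bar> \<le> \<bar>u - v\<bar>" "\<bar>clip u - v\<bar> \<le> 1"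
    using assms unfolding clip_def by linarith+
  then show "(clip u - v)\<^sup>2 \<le> (u - v)\<^sup>2" "(clip u - v)\<^sup>2 \<le> 1"
    by (simp_all add: abs_le_square_iff abs_square_le_1)
qed

text \<open>The segment from \<open>x\<close> to \<open>y\<close> is connected and leaves
  \<open>\<Omega>\<close>, so it meets the frontier at some \<open>z\<close>, where the branches
  differ by at least the jump. As \<open>z\<close> is no farther from \<open>x\<close> or
  \<open>y\<close> than these are from each other, each branch costs one Lipschitz
  increment.\<close>

lemma jump_across_frontier:
  fixes f1 f2 :: "real^'d \<Rightarrow> real"
  assumes lip: "\<And>x y. x \<in> unit_cube \<Longrightarrow> y \<in> unit_cube \<Longrightarrow> \<bar>f1 x - f1 y\<bar> \<le> L * infnorm (x - y)"
      "\<And>x y. x \<in> unit_cube \<Longrightarrow> y \<in> unit_cube \<Longrightarrow> \<bar>f2 x - f2 y\<bar> \<le> L * infnorm (x - y)"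
    and jump: "(INF x\<in>frontier \<Omega>. \<bar>f1 x - f2 x\<bar>) \<ge> c"
    and "x \<in> unit_cube" "y \<in> unit_cube" "x \<in> \<Omega>" "y \<notin> \<Omega>" "L \<ge> 0"
  shows "\<bar>f1 x - f2 y\<bar> \<ge> c - 2 * L * infnorm (x - y)"
proof -
  have "closed_segment x y \<inter> frontier \<Omega> \<noteq> {}"
    using assms(6,7) by (intro connected_Int_frontier connected_segment) auto
  then obtain z where z: "z \<in> closed_segment x y" "z \<in> frontier \<Omega>" by blast
  then obtain u where u: "0 \<le> u" "u \<le> 1" "z = (1 - u) *\<^sub>R x + u *\<^sub>R y"
    by (auto simp: closed_segment_def)
  have zc: "z \<in> unit_cube"
    using z(1) closed_segment_subset[OF assms(4,5) convex_box(1)] by blast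
  have "x - z = u *\<^sub>R (x - y)" "z - y = (1 - u) *\<^sub>R (x - y)"
    by (simp_all add: u(3) algebra_simps)
  then have "infnorm (x - z) = u * infnorm (x - y)" "infnorm (z - y) = (1 - u) * infnorm (x - y)"
    using u by (simp_all add: infnorm_mul)
  then have n: "infnorm (x - z) \<le> infnorm (x - y)" "infnorm (z - y) \<le> infnorm (x - y)"
    using u infnorm_pos_le[of "x - y"] by (simp_all add: mult_left_le_one_le)
  have "c \<le> \<bar>f1 z - f2 z\<bar>"
    using jump by (rule order.trans) (intro cINF_lower z(2) bdd_belowI[of _ 0], auto)
  moreover have "\<bar>f1 x - f1 z\<bar> \<le> L * infnorm (x - y)"
    using lip(1)[OF assms(4) zc] mult_left_mono[OF n(1) assms(8)] by linarith
  moreover have "\<bar>f2 z - f2 y\<bar> \<le> L * infnorm (x - y)"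
    using lip(2)[OF zc assms(5)] mult_left_mono[OF n(2) assms(8)] by linarith
  ultimately show ?thesis by linarith
qed

lemma card_window_le:
  fixes i :: "nat^'d"
  assumes "n \<ge> 1" "h \<ge> 0"
  shows "real (card {j \<in> grid n. infnorm (design n i - design n j) \<le> h}) \<le> (2 * (real n * h) + 1) ^ CARD('d)"
proof -
  define w where "w = nat \<lfloor>real n * h\<rfloor>"
  have w: "real w \<le> real n * h"
    using assms by (simp add: w_def)
  have "j $ k \<in> {i $ k - w .. i $ k + w}" if "infnorm (design n i - design n j) \<le> h" for j k
  proof -
    have "\<bar>(design n i - design n j) $ k\<bar> \<le> h"
      using component_le_infnorm_cart that by (rule order.trans)
    then have "\<bar>real (i $ k) - real (j $ k)\<bar> \<le> real n * h"
      using assms(1) unfolding design_diff by (simp add: field_simps abs_divide)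
    then have "\<bar>int (i $ k) - int (j $ k)\<bar> \<le> \<lfloor>real n * h\<rfloor>"
      by (simp add: le_floor_iff)
    then show ?thesis by (auto simp: w_def)
  qed
  then have "{j \<in> grid n. infnorm (design n i - design n j) \<le> h}
      \<subseteq> {j. \<forall>k. j $ k \<in> {i $ k - w .. i $ k + w}}"
    by blast
  then have "card {j \<in> grid n. infnorm (design n i - design n j) \<le> h}
      \<le> card {j :: nat^'d. \<forall>k. j $ k \<in> {i $ k - w .. i $ k + w}}"
    by (intro card_mono card_vec_box(1)) auto
  also have "\<dots> = (\<Prod>k\<in>UNIV. card {i $ k - w .. i $ k + w})"
    by (rule card_vec_box(2)) simp
  \<comment> \<open>Where \<open>i $ k < w\<close> the subtraction truncates at zero, which only
    shortens the interval.\<close>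
  also have "\<dots> \<le> (\<Prod>k\<in>(UNIV :: 'd set). 2 * w + 1)"
    by (intro prod_mono) auto
  finally have "real (card {j \<in> grid n. infnorm (design n i - design n j) \<le> h}) \<le> real ((2 * w + 1) ^ CARD('d))"
    by (simp only: of_nat_le_iff prod_constant)
  also have "\<dots> \<le> (2 * (real n * h) + 1) ^ CARD('d)"
    unfolding of_nat_power using w by (intro power_mono) auto
  finally show ?thesis .
qed

text \<open>The pixels that a membership oracle keeps: those of the window on the same side of the
  boundary as the centre.\<close>

definition region_window :: "nat \<Rightarrow> real \<Rightarrow> (real^'d) set \<Rightarrow> nat^'d \<Rightarrow> (nat^'d) set" where
  "region_window n h \<Omega> i = {j \<in> grid n. infnorm (design n i - design n j) \<le> h \<and>
     (design n j \<in> \<Omega> \<longleftrightarrow> design n i \<in> \<Omega>)}"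

text \<open>Summing cell by cell replaces the shape of the windows by a count: at most
  \<open>1 / h + 1\<close> cells per coordinate, doubled for the two regions, each contributing at
  most the number of monomials.\<close>

lemma sum_leverage_le:
  fixes H :: "nat^'d \<Rightarrow> nat^'d \<Rightarrow> nat^'d \<Rightarrow> real"
  assumes "h > 0"
    and H: "\<And>i. i \<in> grid n \<Longrightarrow> projection_kernel (\<lambda>s j. mi_power (design n j - design n i) s)
       {s. mi_order s \<le> r} (region_window n h \<Omega> i) (H i)"
  shows "(\<Sum>i\<in>grid n. H i i i)
     \<le> 2 * (1 / h + 1) ^ CARD('d) * real (card {s :: nat^'d. mi_order s \<le> r})"
proof -
  let ?J = "{s :: nat^'d. mi_order s \<le> r}"
  \<comment> \<open>Recording membership in \<open>\<Omega>\<close> cuts each cell along the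
    boundary, so that a cut cell is contained in the region window of each of its pixels.\<close>
  define cell where "cell i = ((\<chi> k. nat \<lfloor>design n i $ k / h\<rfloor>) :: nat^'d, design n i \<in> \<Omega>)" for i
  define T where "T = {c :: nat^'d. \<forall>k. c $ k \<in> {..nat \<lfloor>1 / h\<rfloor>}} \<times> (UNIV :: bool set)"
  have pos: "0 < design n i $ k \<and> design n i $ k < 1" if "i \<in> grid n" for i :: "nat^'d" and k
    using design_in_box[OF that] by (simp add: mem_box_cart)
  have sub: "cell ` grid n \<subseteq> T"
  proof (rule image_subsetI)
    fix i :: "nat^'d" assume "i \<in> grid n"
    then have "nat \<lfloor>design n i $ k / h\<rfloor> \<le> nat \<lfloor>1 / h\<rfloor>" for k
      using pos assms(1) by (intro nat_mono floor_mono divide_right_mono) (auto simp: less_imp_le)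
    then show "cell i \<in> T" by (simp add: cell_def T_def)
  qed
  have fT: "finite T"
    unfolding T_def by (intro finite_SigmaI card_vec_box(1)) auto
  have "card T = (\<Prod>k\<in>(UNIV :: 'd set). card {..nat \<lfloor>1 / h\<rfloor>}) * 2"
    unfolding T_def card_cartesian_product by (subst card_vec_box(2)) auto
  then have "real (card T) = 2 * (real (nat \<lfloor>1 / h\<rfloor>) + 1) ^ CARD('d)"
    by (simp add: add.commute)
  also have "\<dots> \<le> 2 * (1 / h + 1) ^ CARD('d)"
    using assms(1) by (intro mult_left_mono power_mono add_right_mono of_nat_floor) auto
  finally have cT: "real (card T) \<le> 2 * (1 / h + 1) ^ CARD('d)" .
  have cell_sum: "(\<Sum>i | i \<in> grid n \<and> cell i = c. H i i i) \<le> real (card ?J)" for c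
  proof -
    let ?Q = "{i \<in> grid n. cell i = c}"
    \<comment> \<open>One uncentred family serves all pixels of the cell; the centred monomials lie
      in its span, as \<open>leverage_mono\<close> requires.\<close>
    obtain H' where H': "projection_kernel (\<lambda>s j. mi_power (design n j) s) ?J ?Q H'"
      and tr: "(\<Sum>i\<in>?Q. H' i i) \<le> real (card ?J)"
      using projection_kernel_exists[of ?J ?Q "\<lambda>s j. mi_power (design n j) s"] by auto
    have "H i i i \<le> H' i i" if i: "i \<in> ?Q" for i
    proof (rule leverage_mono[OF H' H])
      show "i \<in> grid n" "i \<in> ?Q" using i by auto
      show "finite (region_window n h \<Omega> i)" by (simp add: region_window_def)
      show "\<forall>s\<in>?J. \<exists>a. \<forall>j\<in>region_window n h \<Omega> i.
          mi_power (design n j - design n i) s = (\<Sum>t\<in>?J. a t * mi_power (design n j) t)"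
      proof
        fix s assume "s \<in> ?J"
        then have "poly_fun r (\<lambda>v. mi_power (v - design n i) s)"
          by (intro poly_fun_shift_monom) simp
        then obtain a where "\<And>v. mi_power (v - design n i) s = (\<Sum>t\<in>?J. a t * mi_power v t)"
          by (rule poly_funE) blast
        then show "\<exists>a. \<forall>j\<in>region_window n h \<Omega> i.
            mi_power (design n j - design n i) s = (\<Sum>t\<in>?J. a t * mi_power (design n j) t)"
          by (intro exI[of _ a] ballI)
      qed
      show "?Q \<subseteq> region_window n h \<Omega> i"
      proof
        fix j assume j: "j \<in> ?Q"
        then have "cell j = cell i" using i by simp
        then have e: "nat \<lfloor>design n j $ k / h\<rfloor> = nat \<lfloor>design n i $ k / h\<rfloor>" for k
          by (simp add: cell_def vec_eq_iff)
        \<comment> \<open>Nonnegative reals with equal integer parts differ by at most 1;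
          nonnegativity ensures that \<open>nat\<close> merges no distinct floors.\<close>
        have "\<bar>(design n i - design n j) $ k\<bar> \<le> h" for k
        proof -
          have "0 \<le> design n i $ k / h" "0 \<le> design n j $ k / h"
            using pos[of i k] pos[of j k] i j assms(1) by auto
          then have "\<bar>design n i $ k / h - design n j $ k / h\<bar> \<le> 1"
            using e[of k] by linarith
          then have "\<bar>(design n i - design n j) $ k / h\<bar> \<le> 1"
            by (simp add: diff_divide_distrib)
          then show ?thesis
            using assms(1) by (simp add: abs_divide field_simps)
        qed
        then show "j \<in> region_window n h \<Omega> i"
          using j \<open>cell j = cell i\<close> by (auto simp: region_window_def cell_def intro!: infnorm_cart_le)
      qed
    qed
    then have "(\<Sum>i\<in>?Q. H i i i) \<le> (\<Sum>i\<in>?Q. H' i i)"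
      by (rule sum_mono)
    then show ?thesis using tr by linarith
  qed
  have "(\<Sum>i\<in>grid n. H i i i) = (\<Sum>c\<in>T. \<Sum>i | i \<in> grid n \<and> cell i = c. H i i i)"
    using sum.group[OF finite_grid fT sub, of "\<lambda>i. H i i i"] by simp
  also have "\<dots> \<le> real (card T) * real (card ?J)"
    using cell_sum by (intro sum_bounded_above)
  also have "\<dots> \<le> 2 * (1 / h + 1) ^ CARD('d) * real (card ?J)"
    using cT by (intro mult_right_mono) auto
  finally show ?thesis .
qed

text \<open>The fit reproduces \<open>p\<close>, which agrees with \<open>f\<close> at the centre,
  so only the remainder \<open>f - p\<close> contributes. Cauchy-Schwarz brings in the squared row
  norm, which is the leverage.\<close>

lemma projection_kernel_bias:
  assumes K: "projection_kernel g J S H" "i \<in> S"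
    and p: "\<forall>j\<in>S. p j = (\<Sum>s\<in>J. a s * g s j)" "p i = f i"
    and E: "\<And>j. j \<in> S \<Longrightarrow> \<bar>f j - p j\<bar> \<le> E"
  shows "((\<Sum>j\<in>S. H i j * f j) - f i)\<^sup>2 \<le> H i i * (real (card S) * E\<^sup>2)"
proof -
  have "(\<Sum>j\<in>S. H i j * f j) - f i = (\<Sum>j\<in>S. H i j * (f j - p j))"
    using projection_kernel_reproduce[OF K p(1)] p(2) by (simp add: right_diff_distrib sum_subtractf)
  then have "((\<Sum>j\<in>S. H i j * f j) - f i)\<^sup>2 \<le> (\<Sum>j\<in>S. (H i j)\<^sup>2) * (\<Sum>j\<in>S. (f j - p j)\<^sup>2)"
    using Cauchy_Schwarz_ineq_sum[of "H i" "\<lambda>j. f j - p j" S] by simp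
  also have "\<dots> \<le> (\<Sum>j\<in>S. (H i j)\<^sup>2) * (real (card S) * E\<^sup>2)"
  proof (intro mult_left_mono sum_bounded_above sum_nonneg)
    show "(f j - p j)\<^sup>2 \<le> E\<^sup>2" if "j \<in> S" for j
      using power_mono[OF E[OF that], of 2] by simp
  qed auto
  also have "(\<Sum>j\<in>S. (H i j)\<^sup>2) = H i i"
    using projection_kernel_idem[OF K K(2)] by (simp add: power2_eq_square)
  finally show ?thesis .
qed

section \<open>Risk of the Yaroslavsky estimator\<close>

lemma holder_class_range:
  assumes "g \<in> holder_class \<alpha> C0" "x \<in> unit_cube"
  shows "0 \<le> g x" "g x \<le> 1"
proof -
  have "g x \<in> {0..1}"
    using assms unfolding holder_class_def by blast
  then show "0 \<le> g x" "g x \<le> 1" by auto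
qed

lemma cartoon_classE:
  fixes f :: "real^'d \<Rightarrow> real"
  assumes "f \<in> cartoon_class \<alpha> C0"
  obtains f1 f2 \<Omega> where "f1 \<in> holder_class \<alpha> C0" "f2 \<in> holder_class \<alpha> C0"
    "(INF x\<in>frontier \<Omega>. \<bar>f1 x - f2 x\<bar>) \<ge> 1 / C0"
    "\<And>x. x \<in> unit_cube \<Longrightarrow> x \<in> \<Omega> \<Longrightarrow> f x = f1 x"
    "\<And>x. x \<in> unit_cube \<Longrightarrow> x \<notin> \<Omega> \<Longrightarrow> f x = f2 x"
proof -
  from assms obtain f1 f2 \<Omega> where *: "f1 \<in> holder_class \<alpha> C0" "f2 \<in> holder_class \<alpha> C0"
    "(INF x\<in>frontier \<Omega>. \<bar>f1 x - f2 x\<bar>) \<ge> 1 / C0"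
    "\<forall>x\<in>unit_cube. f x = indicator \<Omega> x * f1 x + indicator (- \<Omega>) x * f2 x"
    unfolding cartoon_class_def mem_Collect_eq by (elim exE conjE)
  show thesis
    by (rule that[OF *(1-3)]) (simp_all add: *(4))
qed

lemma cartoon_class_range:
  assumes "f \<in> cartoon_class \<alpha> C0" "x \<in> unit_cube"
  shows "0 \<le> f x" "f x \<le> 1"
proof -
  obtain f1 f2 \<Omega> where *: "f1 \<in> holder_class \<alpha> C0" "f2 \<in> holder_class \<alpha> C0"
    "(INF x\<in>frontier \<Omega>. \<bar>f1 x - f2 x\<bar>) \<ge> 1 / C0"
    "\<And>x. x \<in> unit_cube \<Longrightarrow> x \<in> \<Omega> \<Longrightarrow> f x = f1 x"
    "\<And>x. x \<in> unit_cube \<Longrightarrow> x \<notin> \<Omega> \<Longrightarrow> f x = f2 x"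
    by (rule cartoon_classE[OF assms(1)]; rule that; assumption)
  have "0 \<le> f x \<and> f x \<le> 1"
    using *(4,5)[OF assms(2)] holder_class_range[OF *(1) assms(2)] holder_class_range[OF *(2) assms(2)]
    by (cases "x \<in> \<Omega>") auto
  then show "0 \<le> f x" "f x \<le> 1" by auto
qed

lemma design_in_cube: "i \<in> grid n \<Longrightarrow> design n i \<in> unit_cube"
  using design_in_box box_subset_cbox by blast

text \<open>The constant monomial already spans all functions on one point, so a fit on a single
  pixel returns the observation.\<close>

lemma projection_kernel_singleton:
  fixes i :: "nat^'d"
  shows "projection_kernel (\<lambda>s j. mi_power (design n j - design n i) s) {s. mi_order s \<le> r} {i} (\<lambda>_ _. 1)"
proof -
  let ?a = "\<lambda>s :: nat^'d. if s = 0 then 1 else 0 :: real"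
  have "(\<Sum>s | mi_order s \<le> r. ?a s * mi_power (design n i - design n i) s) = (\<Sum>s | mi_order s \<le> r. ?a s)"
    by (intro sum.cong refl) simp
  also have "\<dots> = 1"
    by (subst sum.delta) auto
  finally have eq: "(\<Sum>s | mi_order s \<le> r. ?a s * mi_power (design n i - design n i) s) = 1" .
  show ?thesis
    unfolding projection_kernel_def
  proof (intro conjI ballI)
    show "\<exists>a. \<forall>j\<in>{i}. 1 = (\<Sum>s | mi_order s \<le> r. a s * mi_power (design n j - design n i) s)"
      by (intro exI[of _ ?a] ballI) (simp only: singleton_iff eq)
  qed auto
qed

text \<open>Distinct design points are at sup distance at least \<open>1 / n\<close>, which exceeds
  \<open>h\<close>, so the centre alone has positive weight. Clipping does not increase the error,
  which is therefore at most the noise.\<close>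

lemma mse_yf_narrow_window:
  fixes f :: "real^'d \<Rightarrow> real"
  assumes noise: "uncorrelated_noise M (grid n) \<epsilon> \<sigma>" and f: "f \<in> cartoon_class \<alpha> C0"
    and n: "n \<ge> 1" and h: "0 < h" "real n * h < 1" and "hy > 0"
  shows "mse M n \<epsilon> (yf_estimator n r h hy) f \<le> ennreal (\<sigma>\<^sup>2)"
proof -
  have *: "(\<integral>\<^sup>+\<omega>. ennreal ((yf_estimator n r h hy (\<lambda>j. f (design n j) + \<epsilon> j \<omega>) i - f (design n i))\<^sup>2) \<partial>M)
      \<le> ennreal (\<sigma>\<^sup>2)" if i: "i \<in> grid n" for i
  proof -
    have w: "yaroslavsky_weights n h hy y i j = of_bool (j \<in> {i})" if "j \<in> grid n" for y j
    proof (cases "j = i")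
      case True
      then show ?thesis using h(1) \<open>hy > 0\<close> by (simp add: yaroslavsky_weights_def infnorm_0)
    next
      case False
      then obtain k where "j $ k \<noteq> i $ k" by (metis vec_eq_iff)
      then have "1 \<le> \<bar>real (i $ k) - real (j $ k)\<bar>" by linarith
      then have "1 / real n \<le> \<bar>(design n i - design n j) $ k\<bar>"
        unfolding design_diff using n by (simp add: abs_divide divide_right_mono)
      also have "\<dots> \<le> infnorm (design n i - design n j)"
        by (rule component_le_infnorm_cart)
      finally have "infnorm (design n i - design n j) > h"
        using h n by (simp add: field_simps) (smt (verit) mult.commute mult_left_mono of_nat_0_le_iff)
      then show ?thesis using False by (simp add: yaroslavsky_weights_def)
    qed
    have eq: "yf_estimator n r h hy y i = clip (y i)" for y
    proof -
      have "yf_estimator n r h hy y i = clip (\<Sum>j\<in>{i}. 1 * y j)"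
        unfolding yf_estimator_def
        by (rule lpr_estimator_eq[where H = "\<lambda>_ _. 1"]) (simp_all only: projection_kernel_singleton w, use i in auto)
      then show ?thesis by simp
    qed
    have "(\<integral>\<^sup>+\<omega>. ennreal ((yf_estimator n r h hy (\<lambda>j. f (design n j) + \<epsilon> j \<omega>) i - f (design n i))\<^sup>2) \<partial>M)
        \<le> (\<integral>\<^sup>+\<omega>. ennreal ((0 + (\<Sum>j\<in>{i}. 1 * \<epsilon> j \<omega>))\<^sup>2) \<partial>M)"
    proof (intro nn_integral_mono ennreal_leI)
      fix \<omega>
      show "(yf_estimator n r h hy (\<lambda>j. f (design n j) + \<epsilon> j \<omega>) i - f (design n i))\<^sup>2
          \<le> (0 + (\<Sum>j\<in>{i}. 1 * \<epsilon> j \<omega>))\<^sup>2"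
        using clip_sq_le(1)[OF cartoon_class_range[OF f design_in_cube[OF i]], of "f (design n i) + \<epsilon> i \<omega>"]
        by (simp add: eq)
    qed
    also have "\<dots> = ennreal (\<sigma>\<^sup>2)"
      by (subst nn_integral_affine_noise[OF noise]) (use i in auto)
    finally show ?thesis .
  qed
  have "mse M n \<epsilon> (yf_estimator n r h hy) f \<le> (\<Sum>i\<in>(grid n :: (nat^'d) set). ennreal (\<sigma>\<^sup>2)) / ennreal (real n ^ CARD('d))"
    unfolding mse_def by (intro divide_right_mono_ennreal sum_mono *)
  also have "(\<Sum>i\<in>(grid n :: (nat^'d) set). ennreal (\<sigma>\<^sup>2)) = ennreal (real n ^ CARD('d) * \<sigma>\<^sup>2)"
    by (simp add: card_grid ennreal_of_nat_eq_real_of_nat flip: ennreal_mult')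
  also have "\<dots> / ennreal (real n ^ CARD('d)) = ennreal (\<sigma>\<^sup>2)"
    using n by (simp add: divide_ennreal)
  finally show ?thesis .
qed

text \<open>When all noise variables are below \<open>1 / (16 * C0)\<close>, thresholding at \<open>1 / (2 * C0)\<close>
  recovers the region of every pixel in the window: inside a region the signal moves by
  at most \<open>1 / (16 * C0)\<close>, while any segment between the regions crosses a jump of size \<open>1 / C0\<close>.\<close>

lemma yaroslavsky_weights_eq:
  fixes f1 f2 :: "real^'d \<Rightarrow> real"
  assumes lip: "\<And>x y. x \<in> unit_cube \<Longrightarrow> y \<in> unit_cube \<Longrightarrow> \<bar>f1 x - f1 y\<bar> \<le> L * infnorm (x - y)"
      "\<And>x y. x \<in> unit_cube \<Longrightarrow> y \<in> unit_cube \<Longrightarrow> \<bar>f2 x - f2 y\<bar> \<le> L * infnorm (x - y)"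
    and jump: "(INF x\<in>frontier \<Omega>. \<bar>f1 x - f2 x\<bar>) \<ge> 1 / C0"
    and f: "\<And>x. x \<in> unit_cube \<Longrightarrow> x \<in> \<Omega> \<Longrightarrow> f x = f1 x"
      "\<And>x. x \<in> unit_cube \<Longrightarrow> x \<notin> \<Omega> \<Longrightarrow> f x = f2 x"
    and "C0 > 0" "L \<ge> 0" "L * h \<le> 1 / (16 * C0)" "i \<in> grid n" "j \<in> grid n"
    and y: "\<bar>y i - f (design n i)\<bar> \<le> 1 / (16 * C0)" "\<bar>y j - f (design n j)\<bar> \<le> 1 / (16 * C0)"
  shows "yaroslavsky_weights n h (1 / (2 * C0)) y i j = of_bool (j \<in> region_window n h \<Omega> i)"
proof (cases "infnorm (design n i - design n j) \<le> h")
  case False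
  then show ?thesis by (simp add: yaroslavsky_weights_def region_window_def)
next
  case True
  let ?x = "design n i" and ?z = "design n j"
  note cube = design_in_cube[OF \<open>i \<in> grid n\<close>] design_in_cube[OF \<open>j \<in> grid n\<close>]
  \<comment> \<open>In units of \<open>c\<close> the jump is 16 and the threshold 8. Within a region
    the data differ by at most 1 from the signal plus 2 from the noise; across regions by at least
    16 - 2 - 2 = 12.\<close>
  define c where "c = 1 / (16 * C0)"
  have c: "c > 0" "1 / C0 = 16 * c" "1 / (2 * C0) = 8 * c"
    using \<open>C0 > 0\<close> by (simp_all add: c_def)
  have Lh: "L * infnorm (?x - ?z) \<le> c" "L * infnorm (?z - ?x) \<le> c"
    using mult_left_mono[OF True \<open>L \<ge> 0\<close>] assms(8) by (simp_all add: c_def infnorm_sub)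
  have close: "\<bar>y i - y j\<bar> \<le> 8 * c" if "?z \<in> \<Omega> \<longleftrightarrow> ?x \<in> \<Omega>"
  proof -
    have "\<bar>f ?x - f ?z\<bar> \<le> c"
    proof (cases "?x \<in> \<Omega>")
      case True
      then show ?thesis
        using lip(1)[OF cube] f(1)[OF cube(1)] f(1)[OF cube(2)] that Lh by simp
    next
      case False
      then show ?thesis
        using lip(2)[OF cube] f(2)[OF cube(1)] f(2)[OF cube(2)] that Lh by simp
    qed
    then show ?thesis using y c(1) unfolding c_def[symmetric] by linarith
  qed
  have far: "\<bar>y i - y j\<bar> > 8 * c" if ne: "\<not> (?z \<in> \<Omega> \<longleftrightarrow> ?x \<in> \<Omega>)"
  proof -
    have "\<bar>f ?x - f ?z\<bar> \<ge> 14 * c"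
    proof (cases "?x \<in> \<Omega>")
      case True
      with ne have "?z \<notin> \<Omega>" by simp
      then show ?thesis
        using jump_across_frontier[OF lip jump cube True _ \<open>L \<ge> 0\<close>] True Lh f(1)[OF cube(1)] f(2)[OF cube(2)] c
        by simp
    next
      case False
      with ne have "?z \<in> \<Omega>" by simp
      then show ?thesis
        using jump_across_frontier[OF lip jump cube(2,1) _ False \<open>L \<ge> 0\<close>] False Lh f(2)[OF cube(1)] f(1)[OF cube(2)] c
        by (simp add: abs_minus_commute)
    qed
    then show ?thesis using y c(1) unfolding c_def[symmetric] by linarith
  qed
  show ?thesis
    using True close far \<open>j \<in> grid n\<close>
    by (auto simp: yaroslavsky_weights_def region_window_def c(3))
qed

text \<open>\<open>L\<close> and \<open>B\<close> are the constants of
  \<open>holder_lipschitz\<close> and \<open>holder_taylor\<close>. At each pixel the variance and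
  the bias bound share the leverage as a factor, so one application of
  \<open>sum_leverage_le\<close> handles both after averaging.\<close>

lemma mse_yf_le:
  fixes f :: "real^'d \<Rightarrow> real" and \<alpha> C0 :: real and n r :: nat
  defines "\<tau> \<equiv> 1 / (16 * C0)"
  defines "L \<equiv> C0 * real CARD('d) * sqrt (real CARD('d))"
  defines "B \<equiv> real CARD('d) ^ sfloor \<alpha> * C0"
  assumes noise: "uncorrelated_noise M (grid n) \<epsilon> \<sigma>" and f: "f \<in> cartoon_class \<alpha> C0"
    and \<alpha>: "\<alpha> \<ge> 1" and C0: "C0 > 0" and r: "r \<ge> sfloor \<alpha>"
    and n: "n \<ge> 1" and h: "0 < h" "L * h \<le> \<tau>"
    and tail: "\<And>i. i \<in> grid n \<Longrightarrow> measure M {\<omega> \<in> space M. \<bar>\<epsilon> i \<omega>\<bar> \<le> \<tau>} \<ge> 1 - q" "q \<ge> 0"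
  shows "mse M n \<epsilon> (yf_estimator n r h (1 / (2 * C0))) f
    \<le> ennreal (real n ^ CARD('d) * q + 2 * (1 / h + 1) ^ CARD('d) * real (card {s :: nat^'d. mi_order s \<le> r})
         * ((2 * (real n * h) + 1) ^ CARD('d) * (B * h powr \<alpha>)\<^sup>2 + \<sigma>\<^sup>2) / real n ^ CARD('d))"
proof -
  let ?J = "{s :: nat^'d. mi_order s \<le> r}"
  define X where "X = (2 * (real n * h) + 1) ^ CARD('d) * (B * h powr \<alpha>)\<^sup>2 + \<sigma>\<^sup>2"
  define A where "A = {\<omega> \<in> space M. \<exists>i\<in>(grid n :: (nat^'d) set). \<bar>\<epsilon> i \<omega>\<bar> > \<tau>}"
  obtain f1 f2 \<Omega> where f12: "f1 \<in> holder_class \<alpha> C0" "f2 \<in> holder_class \<alpha> C0"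
    and jump: "(INF x\<in>frontier \<Omega>. \<bar>f1 x - f2 x\<bar>) \<ge> 1 / C0"
    and f_eq: "\<And>x. x \<in> unit_cube \<Longrightarrow> x \<in> \<Omega> \<Longrightarrow> f x = f1 x"
      "\<And>x. x \<in> unit_cube \<Longrightarrow> x \<notin> \<Omega> \<Longrightarrow> f x = f2 x"
    by (rule cartoon_classE[OF f]; rule that; assumption)
  note lip = holder_lipschitz[OF \<alpha> C0 f12(1), folded L_def] holder_lipschitz[OF \<alpha> C0 f12(2), folded L_def]
  have L: "L \<ge> 0" using C0 by (simp add: L_def)
  have B: "B \<ge> 0" using C0 by (simp add: B_def)
  have ps: "prob_space M" using noise by (simp add: uncorrelated_noise_def)
  have meas: "\<epsilon> i \<in> borel_measurable M" if "i \<in> grid n" for i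
    using noise that by (simp add: uncorrelated_noise_def)
  have A: "A \<in> sets M" "emeasure M A \<le> ennreal (real n ^ CARD('d) * q)"
    using emeasure_noise_exceeds[where I = "grid n :: (nat^'d) set" and \<epsilon> = \<epsilon>, OF ps finite_grid meas tail]
    by (simp_all add: A_def card_grid)
  let ?S = "region_window n h \<Omega>"
  have S: "i \<in> ?S i" "?S i \<subseteq> grid n" "finite (?S i)" if "i \<in> grid n" for i
    using that h(1) by (auto simp: region_window_def infnorm_0)
  have "\<forall>i\<in>grid n. \<exists>H. projection_kernel (\<lambda>s j. mi_power (design n j - design n i) s) ?J (?S i) H"
    using projection_kernel_exists[OF finite_mi_order_le S(3)] by blast
  then obtain H where H: "\<And>i. i \<in> grid n \<Longrightarrow>
      projection_kernel (\<lambda>s j. mi_power (design n j - design n i) s) ?J (?S i) (H i)"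
    by (rule bchoice[THEN exE]) blast
  have Hnn: "0 \<le> H i i i" if "i \<in> grid n" for i
  proof -
    have "(\<Sum>k\<in>?S i. H i i k * H i i k) = H i i i"
      by (rule projection_kernel_idem[OF H[OF that] S(1)[OF that] S(1)[OF that]])
    then show ?thesis by (metis sum_nonneg zero_le_square)
  qed
  have pixel: "(\<integral>\<^sup>+\<omega>. ennreal ((yf_estimator n r h (1 / (2 * C0)) (\<lambda>j. f (design n j) + \<epsilon> j \<omega>) i - f (design n i))\<^sup>2) \<partial>M)
      \<le> ennreal (real n ^ CARD('d) * q + H i i i * X)" if i: "i \<in> grid n" for i
  proof -
    define b where "b = (\<Sum>j\<in>?S i. H i i j * f (design n j)) - f (design n i)"
    \<comment> \<open>The branch of \<open>f\<close> seen from pixel \<open>i\<close>. It is Holder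
      on the whole cube, so its expansion is valid on all of the region window even though
      \<open>f\<close> may jump along the segments used.\<close>
    define g where "g = (if design n i \<in> \<Omega> then f1 else f2)"
    have g: "g \<in> holder_class \<alpha> C0" using f12 by (simp add: g_def)
    have fg: "f (design n j) = g (design n j)" if "j \<in> ?S i" for j
      using that f_eq design_in_cube[of j n] by (auto simp: g_def region_window_def)
    obtain P where P: "poly_fun (sfloor \<alpha>) P"
      and taylor: "\<And>y. y \<in> box 0 One \<Longrightarrow> \<bar>g y - P (y - design n i)\<bar> \<le> B * infnorm (y - design n i) powr \<alpha>"
      using holder_taylor[OF \<alpha> C0 g design_in_box[OF i], folded B_def] by metis
    obtain a where a: "\<And>v. P v = (\<Sum>t\<in>?J. a t * mi_power v t)"
      using poly_fun_mono[OF P r] by (rule poly_funE) blast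
    have "b\<^sup>2 \<le> H i i i * (real (card (?S i)) * (B * h powr \<alpha>)\<^sup>2)"
      unfolding b_def
    proof (rule projection_kernel_bias[OF H[OF i] S(1)[OF i], where a = a and p = "\<lambda>j. P (design n j - design n i)"
          and f = "\<lambda>j. f (design n j)"])
      show "\<forall>j\<in>?S i. P (design n j - design n i) = (\<Sum>s\<in>?J. a s * mi_power (design n j - design n i) s)"
        by (simp add: a)
      \<comment> \<open>At the centre the Taylor bound is zero, because
        \<open>0 powr \<alpha> = 0\<close>.\<close>
      show "P (design n i - design n i) = f (design n i)"
        using taylor[OF design_in_box[OF i]] fg[OF S(1)[OF i]] \<alpha> by (simp add: infnorm_0)
      fix j assume j: "j \<in> ?S i"
      have "\<bar>f (design n j) - P (design n j - design n i)\<bar> \<le> B * infnorm (design n j - design n i) powr \<alpha>"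
        using taylor[OF design_in_box] j S(2)[OF i] by (auto simp: fg[OF j])
      also have "\<dots> \<le> B * h powr \<alpha>"
        using j \<alpha> B by (intro mult_left_mono powr_mono2)
          (auto simp: region_window_def infnorm_pos_le infnorm_sub[of "design n j"])
      finally show "\<bar>f (design n j) - P (design n j - design n i)\<bar> \<le> B * h powr \<alpha>" .
    qed
    also have "\<dots> \<le> H i i i * ((2 * (real n * h) + 1) ^ CARD('d) * (B * h powr \<alpha>)\<^sup>2)"
    proof (intro mult_left_mono mult_right_mono Hnn i)
      have "card (?S i) \<le> card {j \<in> grid n. infnorm (design n i - design n j) \<le> h}"
        by (intro card_mono) (auto simp: region_window_def)
      then show "real (card (?S i)) \<le> (2 * (real n * h) + 1) ^ CARD('d)"
        using card_window_le[OF n, of h i] h(1) by linarith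
    qed auto
    finally have bias: "b\<^sup>2 \<le> H i i i * ((2 * (real n * h) + 1) ^ CARD('d) * (B * h powr \<alpha>)\<^sup>2)" .
    have H2: "(\<Sum>j\<in>?S i. (H i i j)\<^sup>2) = H i i i"
      using projection_kernel_idem[OF H[OF i] S(1)[OF i] S(1)[OF i]] by (simp add: power2_eq_square)
    have [measurable]: "(\<lambda>\<omega>. \<Sum>j\<in>?S i. H i i j * \<epsilon> j \<omega>) \<in> borel_measurable M"
      using S(2)[OF i] by (intro borel_measurable_sum borel_measurable_times borel_measurable_const meas) auto
    have "(\<integral>\<^sup>+\<omega>. ennreal ((yf_estimator n r h (1 / (2 * C0)) (\<lambda>j. f (design n j) + \<epsilon> j \<omega>) i - f (design n i))\<^sup>2) \<partial>M)
        \<le> (\<integral>\<^sup>+\<omega>. indicator A \<omega> + ennreal ((b + (\<Sum>j\<in>?S i. H i i j * \<epsilon> j \<omega>))\<^sup>2) \<partial>M)"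
    proof (rule nn_integral_mono)
      fix \<omega> assume \<omega>: "\<omega> \<in> space M"
      define y where "y = (\<lambda>j. f (design n j) + \<epsilon> j \<omega>)"
      note rng = cartoon_class_range[OF f design_in_cube[OF i]]
      show "ennreal ((yf_estimator n r h (1 / (2 * C0)) (\<lambda>j. f (design n j) + \<epsilon> j \<omega>) i - f (design n i))\<^sup>2)
          \<le> indicator A \<omega> + ennreal ((b + (\<Sum>j\<in>?S i. H i i j * \<epsilon> j \<omega>))\<^sup>2)"
      \<comment> \<open>On \<open>A\<close> clipping bounds the loss by 1. Off \<open>A\<close> the
        random weights coincide with the fixed region window, so that before clipping the fit is
        linear in the data.\<close>
      proof (cases "\<omega> \<in> A")
        case True
        have "(yf_estimator n r h (1 / (2 * C0)) y i - f (design n i))\<^sup>2 \<le> 1"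
          unfolding yf_estimator_def lpr_estimator_def Let_def by (rule clip_sq_le(2)[OF rng])
        then have "ennreal ((yf_estimator n r h (1 / (2 * C0)) y i - f (design n i))\<^sup>2) \<le> 1"
          by simp
        then show ?thesis
          using True unfolding y_def by (simp add: add_increasing2)
      next
        case False
        then have small: "\<bar>y j - f (design n j)\<bar> \<le> 1 / (16 * C0)" if "j \<in> grid n" for j
          using that \<omega> by (auto simp: A_def y_def \<tau>_def not_less)
        have w: "yaroslavsky_weights n h (1 / (2 * C0)) y i j = of_bool (j \<in> ?S i)" if "j \<in> grid n" for j
          by (rule yaroslavsky_weights_eq[OF lip jump f_eq C0 L h(2)[unfolded \<tau>_def] i that small[OF i] small[OF that]])
        have "yf_estimator n r h (1 / (2 * C0)) y i = clip (\<Sum>j\<in>?S i. H i i j * y j)"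
          unfolding yf_estimator_def by (rule lpr_estimator_eq[where w = "yaroslavsky_weights n h (1 / (2 * C0)) y",
              OF H[OF i] S(1)[OF i] S(2)[OF i] w])
        then have "(yf_estimator n r h (1 / (2 * C0)) y i - f (design n i))\<^sup>2
            \<le> ((\<Sum>j\<in>?S i. H i i j * y j) - f (design n i))\<^sup>2"
          using clip_sq_le(1)[OF rng] by simp
        also have "(\<Sum>j\<in>?S i. H i i j * y j) - f (design n i) = b + (\<Sum>j\<in>?S i. H i i j * \<epsilon> j \<omega>)"
          by (simp add: y_def b_def distrib_left sum.distrib)
        finally show ?thesis
          unfolding y_def by (intro add_increasing ennreal_leI) auto
      qed
    qed
    also have "\<dots> = emeasure M A + (\<integral>\<^sup>+\<omega>. ennreal ((b + (\<Sum>j\<in>?S i. H i i j * \<epsilon> j \<omega>))\<^sup>2) \<partial>M)"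
      using A(1) by (subst nn_integral_add) auto
    also have "\<dots> = emeasure M A + ennreal (b\<^sup>2 + \<sigma>\<^sup>2 * H i i i)"
      using nn_integral_affine_noise[OF noise S(2)[OF i] S(3)[OF i]] by (simp add: H2)
    also have "\<dots> \<le> ennreal (real n ^ CARD('d) * q) + ennreal (H i i i * X)"
      using bias by (intro add_mono A(2) ennreal_leI) (simp add: X_def distrib_left mult.commute)
    also have "\<dots> = ennreal (real n ^ CARD('d) * q + H i i i * X)"
      using tail(2) Hnn[OF i] h(1) by (intro ennreal_plus[symmetric]) (auto simp: X_def)
    finally show ?thesis .
  qed
  have Xnn: "X \<ge> 0" using h(1) by (auto simp: X_def)
  have "mse M n \<epsilon> (yf_estimator n r h (1 / (2 * C0))) f
      \<le> (\<Sum>i\<in>(grid n :: (nat^'d) set). ennreal (real n ^ CARD('d) * q + H i i i * X)) / ennreal (real n ^ CARD('d))"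
    unfolding mse_def by (intro divide_right_mono_ennreal sum_mono pixel)
  also have "(\<Sum>i\<in>(grid n :: (nat^'d) set). ennreal (real n ^ CARD('d) * q + H i i i * X))
      = ennreal (\<Sum>i\<in>(grid n :: (nat^'d) set). real n ^ CARD('d) * q + H i i i * X)"
    using tail(2) Xnn Hnn by (intro sum_ennreal) auto
  also have "(\<Sum>i\<in>(grid n :: (nat^'d) set). real n ^ CARD('d) * q + H i i i * X)
      = real n ^ CARD('d) * (real n ^ CARD('d) * q) + (\<Sum>i\<in>(grid n :: (nat^'d) set). H i i i) * X"
    by (simp add: sum.distrib card_grid sum_distrib_right)
  also have "ennreal \<dots> / ennreal (real n ^ CARD('d))
      = ennreal (real n ^ CARD('d) * q + (\<Sum>i\<in>(grid n :: (nat^'d) set). H i i i) * X / real n ^ CARD('d))"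
    using n tail(2) Xnn Hnn by (subst divide_ennreal) (auto simp: add_divide_distrib intro!: add_nonneg_nonneg mult_nonneg_nonneg sum_nonneg)
  also have "\<dots> \<le> ennreal (real n ^ CARD('d) * q + 2 * (1 / h + 1) ^ CARD('d) * real (card ?J) * X / real n ^ CARD('d))"
    by (intro ennreal_leI add_left_mono divide_right_mono mult_right_mono
        sum_leverage_le[where H = H and \<Omega> = \<Omega>] h(1) H Xnn) auto
  finally show ?thesis unfolding X_def .
qed

section \<open>Arithmetic of the oracle bandwidth and of the noise tail\<close>

text \<open>The bandwidth solves
  \<open>h powr (d + 2 * \<alpha>) = \<sigma>\<^sup>2 / n ^ d\<close>, so squared bias
  \<open>h powr (2 * \<alpha>)\<close> and variance \<open>\<sigma>\<^sup>2 / (n * h) ^ d\<close>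
  balance at the rate.\<close>

lemma bandwidth_MO_powr:
  fixes \<alpha> \<sigma> :: real and d n :: nat
  assumes "\<alpha> > 0" "\<sigma> > 0" "n \<ge> 1"
  defines "h \<equiv> bandwidth_MO d \<alpha> \<sigma> n"
  shows "h > 0" "h powr (2 * \<alpha>) = rate_MO d \<alpha> \<sigma> n"
    and "\<sigma>\<^sup>2 = (real n * h) ^ d * rate_MO d \<alpha> \<sigma> n"
proof -
  define v where "v = \<sigma>\<^sup>2 / real n ^ d"
  have v: "v > 0" using assms by (simp add: v_def)
  have h: "h = v powr (1 / (real d + 2 * \<alpha>))" by (simp add: h_def bandwidth_MO_def v_def)
  show hp: "h > 0" using v by (simp add: h)
  show R: "h powr (2 * \<alpha>) = rate_MO d \<alpha> \<sigma> n"
    by (simp add: h powr_powr rate_MO_def v_def)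
  have "h ^ d * h powr (2 * \<alpha>) = h powr (real d + 2 * \<alpha>)"
    using hp by (simp add: powr_add powr_realpow)
  also have "\<dots> = v"
    using v assms(1) by (simp add: h powr_powr add_nonneg_pos less_imp_neq[symmetric])
  finally have "real n ^ d * (h ^ d * h powr (2 * \<alpha>)) = \<sigma>\<^sup>2"
    using assms(3) by (simp add: v_def)
  then show "\<sigma>\<^sup>2 = (real n * h) ^ d * rate_MO d \<alpha> \<sigma> n"
    by (simp only: R power_mult_distrib mult.assoc)
qed

text \<open>Since \<open>n ^ d\<close> is at least 1, a condition on the noise level alone makes the
  bandwidth small.\<close>

lemma bandwidth_MO_le:
  assumes "\<alpha> > 0" "\<sigma> > 0" "n \<ge> 1" "h0 > 0" "\<sigma> \<le> h0 powr ((real d + 2 * \<alpha>) / 2)"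
  shows "bandwidth_MO d \<alpha> \<sigma> n \<le> h0"
proof -
  have "\<sigma>\<^sup>2 / real n ^ d \<le> \<sigma>\<^sup>2"
    using assms(3) by (simp add: divide_le_eq mult_right_le_one_le one_le_power mult_le_cancel_left1)
  also have "\<sigma>\<^sup>2 \<le> (h0 powr ((real d + 2 * \<alpha>) / 2))\<^sup>2"
    using assms by (intro power_mono) auto
  also have "\<dots> = h0 powr (real d + 2 * \<alpha>)"
    using assms(4) by (simp add: power2_eq_square flip: powr_add)
  finally have "bandwidth_MO d \<alpha> \<sigma> n \<le> (h0 powr (real d + 2 * \<alpha>)) powr (1 / (real d + 2 * \<alpha>))"
    unfolding bandwidth_MO_def using assms(1) by (intro powr_mono2) auto
  also have "\<dots> = h0"
    using assms(1,4) by (simp add: powr_powr add_nonneg_pos less_imp_neq[symmetric])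
  finally show ?thesis .
qed

text \<open>The factor in front of \<open>ln n\<close> is tuned: the bound on \<sigma> makes
  \<open>\<sigma> powr b\<close> at most the inverse of
  \<open>\<kappa> * (C / \<tau>) powr b * ln n\<close>, so multiplying the inverse of
  \<open>\<sigma> powr b\<close> by \<open>(\<tau> / C) powr b\<close> leaves at least
  \<open>\<kappa> * ln n\<close>.\<close>

lemma stretched_exp_tail_le:
  fixes \<sigma> \<tau> C b \<kappa> :: real
  assumes "\<sigma> > 0" "\<tau> > 0" "C > 0" "b > 0" "\<kappa> > 0" "n > 1"
    and \<sigma>: "\<sigma> \<le> (\<kappa> * (C / \<tau>) powr b * ln n) powr (- 1 / b)"
  shows "exp (- ((\<tau> / \<sigma> / C) powr b)) \<le> n powr (- \<kappa>)"
proof -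
  let ?C' = "\<kappa> * (C / \<tau>) powr b"
  have ln: "ln n > 0" and C': "?C' > 0" using assms by auto
  have "\<sigma> powr b \<le> ((?C' * ln n) powr (- 1 / b)) powr b"
    using assms by (intro powr_mono2) auto
  also have "\<dots> = (?C' * ln n) powr (- 1)"
    using \<open>b > 0\<close> by (simp only: powr_powr) simp
  also have "\<dots> = inverse (?C' * ln n)"
    using ln C' by (subst powr_minus) (simp only: powr_one mult_nonneg_nonneg less_imp_le)
  finally have *: "\<sigma> powr b \<le> inverse (?C' * ln n)" .
  have "(\<tau> / \<sigma> / C) powr b = inverse ((C / \<tau>) powr b) * inverse (\<sigma> powr b)"
    using assms(1-3) by (simp add: powr_divide powr_mult field_simps)
  also have "\<dots> \<ge> inverse ((C / \<tau>) powr b) * (?C' * ln n)"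
  proof (rule mult_left_mono)
    have "inverse (inverse (?C' * ln n)) \<le> inverse (\<sigma> powr b)"
      using * assms(1) by (intro le_imp_inverse_le) auto
    then show "?C' * ln n \<le> inverse (\<sigma> powr b)" by (simp only: inverse_inverse_eq)
  qed simp
  also have "inverse ((C / \<tau>) powr b) * (?C' * ln n) = \<kappa> * ln n"
    using assms(2,3) by simp
  finally have "exp (- ((\<tau> / \<sigma> / C) powr b)) \<le> exp (- (\<kappa> * ln n))" by simp
  also have "\<dots> = n powr (- \<kappa>)"
    using assms(6) by (simp add: powr_def)
  finally show ?thesis .
qed

text \<open>In \<open>K\<close>, the first 2 counts the regions, \<open>2 ^ CARD('d)\<close> comes
  from \<open>1 / h + 1 \<le> 2 / h\<close>, \<open>3 ^ CARD('d)\<close> from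
  \<open>2 * (n * h) + 1 \<le> 3 * (n * h)\<close>, the inner 1 from the variance; the outer 1 gives
  \<open>K \<ge> 1\<close> for the single-pixel case. In the tail exponent, the dimension pays for
  the union bound, \<open>2 * \<alpha>\<close> brings the term below the rate, and the last 1 leaves
  the vanishing factor \<open>C / n\<close>.\<close>

lemma risk_yf_le:
  fixes \<alpha> C0 C q \<sigma> :: real and n r :: nat and \<epsilon> :: "nat^'d \<Rightarrow> 'a \<Rightarrow> real"
  defines "h \<equiv> bandwidth_MO CARD('d) \<alpha> \<sigma> n" and "R \<equiv> rate_MO CARD('d) \<alpha> \<sigma> n"
  defines "L \<equiv> C0 * real CARD('d) * sqrt (real CARD('d))"
  defines "B \<equiv> real CARD('d) ^ sfloor \<alpha> * C0"
  defines "K \<equiv> 1 + 2 * 2 ^ CARD('d) * real (card {s :: nat^'d. mi_order s \<le> r}) * (3 ^ CARD('d) * B\<^sup>2 + 1)"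
  assumes noise: "uncorrelated_noise M (grid n) \<epsilon> \<sigma>" and \<sigma>: "\<sigma> > 0"
    and \<alpha>: "\<alpha> \<ge> 1" and C0: "C0 > 0" and r: "r \<ge> sfloor \<alpha>" and n: "n \<ge> 1" and C: "C > 0"
    and h: "h \<le> 1" "L * h \<le> 1 / (16 * C0)"
    and tail: "\<And>i. i \<in> grid n \<Longrightarrow> measure M {\<omega> \<in> space M. \<bar>\<epsilon> i \<omega>\<bar> \<le> 1 / (16 * C0)} \<ge> 1 - C * real n powr (- (real CARD('d) + 2 * \<alpha> + 1))"
  shows "risk M n \<epsilon> (yf_estimator n r h (1 / (2 * C0))) (cartoon_class \<alpha> C0) \<le> ennreal ((1 + C / real n) * (K * R))"
proof -
  have hp: "h > 0" and hR: "h powr (2 * \<alpha>) = R" and \<sigma>R: "\<sigma>\<^sup>2 = (real n * h) ^ CARD('d) * R"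
    using bandwidth_MO_powr[of \<alpha> \<sigma> n "CARD('d)"] \<alpha> \<sigma> n by (simp_all add: h_def R_def)
  have Rp: "R > 0" using hp hR by auto
  have K1: "K \<ge> 1" by (auto simp: K_def intro!: mult_nonneg_nonneg)
  have RK: "R \<le> K * R"
    using mult_right_mono[OF K1, of R] Rp by simp
  show ?thesis
    unfolding risk_def
  proof (rule SUP_least)
    fix f :: "real^'d \<Rightarrow> real" assume f: "f \<in> cartoon_class \<alpha> C0"
    show "mse M n \<epsilon> (yf_estimator n r h (1 / (2 * C0))) f \<le> ennreal ((1 + C / real n) * (K * R))"
    proof (cases "real n * h < 1")
      case True
      have "mse M n \<epsilon> (yf_estimator n r h (1 / (2 * C0))) f \<le> ennreal (\<sigma>\<^sup>2)"
        using C0 by (intro mse_yf_narrow_window[OF noise f n hp True]) simp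
      also have "\<sigma>\<^sup>2 \<le> 1 * R"
        unfolding \<sigma>R using True hp Rp by (intro mult_right_mono power_le_one) auto
      also have "1 * R \<le> (1 + C / real n) * (K * R)"
        using RK Rp C by (intro mult_mono) auto
      finally show ?thesis by (simp add: ennreal_leI)
    next
      case False
      let ?d = "CARD('d)" and ?J = "real (card {s :: nat^'d. mi_order s \<le> r})"
      define q where "q = C * real n powr (- (real ?d + 2 * \<alpha> + 1))"
      have n0: "real n > 0" using n by simp
      have "mse M n \<epsilon> (yf_estimator n r h (1 / (2 * C0))) f
          \<le> ennreal (real n ^ ?d * q + 2 * (1 / h + 1) ^ ?d * ?J
               * ((2 * (real n * h) + 1) ^ ?d * (B * h powr \<alpha>)\<^sup>2 + \<sigma>\<^sup>2) / real n ^ ?d)"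
        unfolding B_def using C h(2) tail
        by (intro mse_yf_le[OF noise f \<alpha> C0 r n hp]) (auto simp: L_def q_def)
      also have "\<dots> \<le> ennreal ((1 + C / real n) * (K * R))"
      proof (rule ennreal_leI)
        have "(1 / real n) powr (2 * \<alpha>) \<le> R"
          unfolding hR[symmetric] using False n0 \<alpha> by (intro powr_mono2) (auto simp: field_simps)
        then have "real n powr (- (2 * \<alpha>)) \<le> R"
          using n0 by (simp add: powr_minus powr_divide inverse_eq_divide)
        moreover have "real n ^ ?d * q = C / real n * real n powr (- (2 * \<alpha>))"
        proof -
          have "real n ^ ?d * q = C * (real n powr real ?d * real n powr (- (real ?d + 2 * \<alpha> + 1)))"
            using n0 by (simp add: q_def powr_realpow)
          also have "\<dots> = C * (real n powr (- 1) * real n powr (- (2 * \<alpha>)))"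
            by (simp only: powr_add[symmetric]) (simp add: algebra_simps)
          finally show ?thesis using n0 by (simp add: powr_minus_divide)
        qed
        ultimately have tail_part: "real n ^ ?d * q \<le> C / real n * R"
          using C n0 by (simp only: mult_left_mono divide_nonneg_nonneg less_imp_le)
        have "(B * h powr \<alpha>)\<^sup>2 = B\<^sup>2 * R"
          unfolding hR[symmetric] by (simp add: power_mult_distrib power2_eq_square flip: powr_add)
        moreover have "(2 * (real n * h) + 1) ^ ?d \<le> (3 * (real n * h)) ^ ?d"
        proof (rule power_mono)
          show "2 * (real n * h) + 1 \<le> 3 * (real n * h)" using False by linarith
        qed (use hp in simp)
        ultimately have "(2 * (real n * h) + 1) ^ ?d * (B * h powr \<alpha>)\<^sup>2 + \<sigma>\<^sup>2
            \<le> (3 * (real n * h)) ^ ?d * (B\<^sup>2 * R) + (real n * h) ^ ?d * R"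
          unfolding \<sigma>R using Rp by (simp add: mult_right_mono)
        also have "\<dots> = (real n * h) ^ ?d * ((3 ^ ?d * B\<^sup>2 + 1) * R)"
          unfolding power_mult_distrib[of 3] by (simp add: algebra_simps)
        finally have pixel: "(2 * (real n * h) + 1) ^ ?d * (B * h powr \<alpha>)\<^sup>2 + \<sigma>\<^sup>2
            \<le> (real n * h) ^ ?d * ((3 ^ ?d * B\<^sup>2 + 1) * R)" .
        have "(1 / h + 1) ^ ?d \<le> (2 / h) ^ ?d"
          using hp h(1) by (intro power_mono) (auto simp: field_simps)
        then have "2 * (1 / h + 1) ^ ?d * ?J * ((2 * (real n * h) + 1) ^ ?d * (B * h powr \<alpha>)\<^sup>2 + \<sigma>\<^sup>2) / real n ^ ?d
            \<le> 2 * (2 / h) ^ ?d * ?J * ((real n * h) ^ ?d * ((3 ^ ?d * B\<^sup>2 + 1) * R)) / real n ^ ?d"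
          using hp Rp by (intro divide_right_mono mult_mono pixel) auto
        \<comment> \<open>The averaged leverage, of order \<open>1 / (n * h) ^ d\<close>, cancels
          the window size in the bracket.\<close>
        also have "\<dots> = (K - 1) * R"
          using n0 hp by (simp add: K_def power_mult_distrib power_divide)
        finally have "real n ^ ?d * q + 2 * (1 / h + 1) ^ ?d * ?J
            * ((2 * (real n * h) + 1) ^ ?d * (B * h powr \<alpha>)\<^sup>2 + \<sigma>\<^sup>2) / real n ^ ?d
            \<le> C / real n * R + (K - 1) * R"
          using tail_part by (rule add_mono[rotated])
        also have "\<dots> \<le> C / real n * (K * R) + K * R"
          using RK Rp C by (intro add_mono mult_left_mono) (auto simp: left_diff_distrib)
        finally show "real n ^ ?d * q + 2 * (1 / h + 1) ^ ?d * ?J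
            * ((2 * (real n * h) + 1) ^ ?d * (B * h powr \<alpha>)\<^sup>2 + \<sigma>\<^sup>2) / real n ^ ?d
            \<le> (1 + C / real n) * (K * R)"
          by (simp only: distrib_right mult_1_left add.commute)
      qed
      finally show ?thesis .
    qed
  qed
qed

text \<open>\<open>K\<close> is chosen before the noise law, so the rate is attained up to a
  constant common to all laws; \<open>C'\<close> may depend on the law, and \<open>e\<close> is the
  vanishing relative error. The infimum is bounded through explicit bandwidths.\<close>

theorem theorem4p4:
  fixes \<alpha> C0 :: real and r :: nat
  assumes "\<alpha> \<ge> 1" and "C0 > 0" and "r \<ge> sfloor \<alpha>"
  shows "\<exists>K>0. \<forall>(D :: real measure) (F :: real \<Rightarrow> real) (C :: real) (b :: real).
    real_distribution D \<and> F = cdf D \<and> C > 0 \<and> b > 0 \<and>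
    (\<forall>\<^sub>F t in at_top. 1 - F t \<le> C * exp (- ((t / C) powr b))) \<longrightarrow>
    (\<exists>C'>0. \<forall>(M :: nat \<Rightarrow> 'a measure) (\<epsilon> :: nat \<Rightarrow> nat^'d \<Rightarrow> 'a \<Rightarrow> real) (\<sigma> :: nat \<Rightarrow> real).
       (\<forall>n\<ge>1. \<sigma> n > 0 \<and> uncorrelated_noise (M n) (grid n) (\<epsilon> n) (\<sigma> n) \<and>
          (\<forall>i\<in>grid n. \<forall>t. measure (M n) {\<omega> \<in> space (M n). \<bar>\<epsilon> n i \<omega>\<bar> \<le> t} \<ge> F (t / \<sigma> n))) \<and>
       (\<forall>\<^sub>F n in sequentially. \<sigma> n \<le> (C' * ln (real n)) powr (- 1 / b)) \<longrightarrow>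
       (\<exists>(e :: nat \<Rightarrow> real) (h :: nat \<Rightarrow> real) (hy :: nat \<Rightarrow> real).
          e \<in> o(\<lambda>_. 1) \<and>
          h \<in> \<Theta>(\<lambda>n. bandwidth_MO CARD('d) \<alpha> (\<sigma> n) n) \<and> hy \<in> \<Theta>(\<lambda>_. 1) \<and>
          (\<forall>\<^sub>F n in sequentially.
             (INF (h', hy') \<in> {0<..} \<times> {0<..}.
                risk (M n) n (\<epsilon> n) (yf_estimator n r h' hy') (cartoon_class \<alpha> C0))
               \<le> ennreal ((1 + e n) * (K * rate_MO CARD('d) \<alpha> (\<sigma> n) n)) \<and>
             h n > 0 \<and> hy n > 0 \<and>
             risk (M n) n (\<epsilon> n) (yf_estimator n r (h n) (hy n)) (cartoon_class \<alpha> C0)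
               \<le> ennreal ((1 + e n) * (K * rate_MO CARD('d) \<alpha> (\<sigma> n) n)))))"
proof -
  define K where "K = 1 + 2 * 2 ^ CARD('d) * real (card {s :: nat^'d. mi_order s \<le> r})
    * (3 ^ CARD('d) * (real CARD('d) ^ sfloor \<alpha> * C0)\<^sup>2 + 1)"
  define \<tau> where "\<tau> = 1 / (16 * C0)"
  define L where "L = C0 * real CARD('d) * sqrt (real CARD('d))"
  \<comment> \<open>The tail exponent required by \<open>risk_yf_le\<close>.\<close>
  define \<kappa> where "\<kappa> = real CARD('d) + 2 * \<alpha> + 1"
  \<comment> \<open>A bandwidth below \<open>h0\<close> satisfies both smallness conditions of
    \<open>risk_yf_le\<close>.\<close>
  define h0 where "h0 = min 1 (\<tau> / L)"
  have pos: "K > 0" "\<tau> > 0" "L > 0" "\<kappa> > 0" "h0 > 0"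
    using assms by (auto simp: K_def \<tau>_def L_def \<kappa>_def h0_def intro!: add_pos_nonneg mult_nonneg_nonneg)
  show ?thesis
  proof (rule exI[of _ K], intro conjI allI impI, goal_cases)
    case 1
    show ?case by (rule pos)
  next
    case (2 D F C b)
    then have C: "C > 0" and b: "b > 0"
      and tail: "\<forall>\<^sub>F t in at_top. 1 - F t \<le> C * exp (- ((t / C) powr b))" by auto
    \<comment> \<open>The value for which \<open>stretched_exp_tail_le\<close> gives a tail of
      \<open>n powr (- \<kappa>)\<close> at level \<tau>.\<close>
    define C' where "C' = \<kappa> * (C / \<tau>) powr b"
    have C': "C' > 0" using pos C by (simp add: C'_def)
    show ?case
    proof (rule exI[of _ C'], intro conjI allI impI, goal_cases)
      case 1
      show ?case by (rule C')
    next
      case (2 M \<epsilon> \<sigma>)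
      then have noise: "\<sigma> n > 0" "uncorrelated_noise (M n) (grid n) (\<epsilon> n) (\<sigma> n)"
          "\<And>i t. i \<in> grid n \<Longrightarrow> measure (M n) {\<omega> \<in> space (M n). \<bar>\<epsilon> n i \<omega>\<bar> \<le> t} \<ge> F (t / \<sigma> n)" if "n \<ge> 1" for n
        using that by auto
      from 2 have \<sigma>_le: "\<forall>\<^sub>F n in sequentially. \<sigma> n \<le> (C' * ln (real n)) powr (- 1 / b)"
        by blast
      define h where "h = (\<lambda>n. bandwidth_MO CARD('d) \<alpha> (\<sigma> n) n)"
      define e where "e = (\<lambda>n. C / real n)"
      define R where "R = (\<lambda>n. rate_MO CARD('d) \<alpha> (\<sigma> n) n)"
      \<comment> \<open>As \<open>b\<close> is positive and \<open>ln n\<close> diverges, the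
        assumed bound forces the noise level to zero.\<close>
      have \<sigma>_small: "\<forall>\<^sub>F n in sequentially. \<sigma> n \<le> \<delta>" if "\<delta> > 0" for \<delta>
      proof -
        have "filterlim (\<lambda>n. C' * ln (real n)) at_top sequentially"
          by (intro filterlim_tendsto_pos_mult_at_top[OF tendsto_const C']
              filterlim_compose[OF ln_at_top filterlim_real_sequentially])
        then have "(\<lambda>n. (C' * ln (real n)) powr (- 1 / b)) \<longlonglongrightarrow> 0"
          using b by (intro tendsto_neg_powr) auto
        then have "\<forall>\<^sub>F n in sequentially. (C' * ln (real n)) powr (- 1 / b) < \<delta>"
          using that by (rule order_tendstoD)
        with \<sigma>_le show ?thesis by eventually_elim linarith
      qed
      obtain t0 where t0: "\<And>t. t \<ge> t0 \<Longrightarrow> 1 - F t \<le> C * exp (- ((t / C) powr b))"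
        using tail unfolding eventually_at_top_linorder by blast
      \<comment> \<open>Two noise thresholds: below the first, \<open>\<tau> / \<sigma> n\<close> is
        in the range where the tail bound holds, the shift by 1 keeping the denominator positive;
        below the second, the bandwidth is at most \<open>h0\<close>.\<close>
      have \<delta>: "\<tau> / (\<bar>t0\<bar> + 1) > 0" "h0 powr ((real CARD('d) + 2 * \<alpha>) / 2) > 0"
        using pos by auto
      have "\<forall>\<^sub>F n in sequentially. h n > 0 \<and>
          risk (M n) n (\<epsilon> n) (yf_estimator n r (h n) (1 / (2 * C0))) (cartoon_class \<alpha> C0)
            \<le> ennreal ((1 + e n) * (K * R n))"
        using \<sigma>_le \<sigma>_small[OF \<delta>(1)] \<sigma>_small[OF \<delta>(2)] eventually_ge_at_top[of 2]
      proof eventually_elim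
        case (elim n)
        \<comment> \<open>From \<open>n \<ge> 2\<close> on, \<open>ln n\<close> is positive, as the
          tail estimate needs.\<close>
        then have n: "n \<ge> 1" and n1: "real n > 1" by auto
        have h: "h n \<le> h0" "h n > 0"
          using bandwidth_MO_le[OF _ noise(1)[OF n] n pos(5) elim(3)]
            bandwidth_MO_powr(1)[OF _ noise(1)[OF n] n] assms(1) by (auto simp: h_def)
        have "L * h n \<le> L * (\<tau> / L)"
          using h pos by (intro mult_left_mono) (auto simp: h0_def)
        then have Lh: "L * h n \<le> \<tau>" using pos by simp
        have "t0 \<le> \<tau> / \<sigma> n"
        proof -
          have "t0 * \<sigma> n \<le> (\<bar>t0\<bar> + 1) * \<sigma> n"
            using noise(1)[OF n] by (intro mult_right_mono) auto
          also have "\<dots> \<le> \<tau>" using elim(2) by (simp add: pos_le_divide_eq mult.commute)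
          finally show ?thesis using noise(1)[OF n] by (simp add: pos_le_divide_eq)
        qed
        then have "1 - F (\<tau> / \<sigma> n) \<le> C * exp (- ((\<tau> / \<sigma> n / C) powr b))"
          by (rule t0)
        also have "\<dots> \<le> C * real n powr (- \<kappa>)"
          using stretched_exp_tail_le[OF noise(1)[OF n] pos(2) C b pos(4) n1 elim(1)[unfolded C'_def]] C
          by (intro mult_left_mono) auto
        finally have "1 - C * real n powr (- \<kappa>) \<le> measure (M n) {\<omega> \<in> space (M n). \<bar>\<epsilon> n i \<omega>\<bar> \<le> \<tau>}"
          if "i \<in> grid n" for i
          using noise(3)[OF n that, of \<tau>] by linarith
        then have "risk (M n) n (\<epsilon> n) (yf_estimator n r (h n) (1 / (2 * C0))) (cartoon_class \<alpha> C0)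
            \<le> ennreal ((1 + C / real n) * (K * R n))"
          using h Lh unfolding K_def R_def h_def
          by (intro risk_yf_le[OF noise(2)[OF n] noise(1)[OF n] assms n C])
            (auto simp: h0_def \<tau>_def L_def \<kappa>_def)
        then show ?case using h by (simp add: e_def)
      qed
      then have "\<forall>\<^sub>F n in sequentially.
             (INF (h', hy') \<in> {0<..} \<times> {0<..}.
                risk (M n) n (\<epsilon> n) (yf_estimator n r h' hy') (cartoon_class \<alpha> C0))
               \<le> ennreal ((1 + e n) * (K * R n)) \<and>
             h n > 0 \<and> 1 / (2 * C0) > 0 \<and>
             risk (M n) n (\<epsilon> n) (yf_estimator n r (h n) (1 / (2 * C0))) (cartoon_class \<alpha> C0)
               \<le> ennreal ((1 + e n) * (K * R n))"
        by eventually_elim (use assms(2) in \<open>auto intro!: INF_lower2[where i = "(h _, 1 / (2 * C0))"]\<close>)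
      moreover have "e \<in> o(\<lambda>_. 1)"
        unfolding e_def by (intro smalloI_tendsto) (auto intro: lim_const_over_n)
      moreover have "(\<lambda>_ :: nat. 1 / (2 * C0)) \<in> \<Theta>(\<lambda>_. 1 :: real)"
        using assms(2) by simp
      ultimately show ?case
        by (intro exI[of _ e] exI[of _ h] exI[of _ "\<lambda>_. 1 / (2 * C0)"] conjI)
          (auto simp: h_def R_def)
    qed
  qed
qed

end
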